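(* Let $m>0$, $0<q<1$, let $u_0\ge 0$ be continuous on $\mathbb{R}$ with compact support $[-s_0,s_0]$, and let $(u_h^n)$ be the numerical solution defined in the context, with $v_h^n$ the piecewise constant derivative of $u_h^n$. Put $T_1=\frac{1}{mq\|u_h^0\|_\infty^q}$ (read as $+\infty$ if $u_h^0\equiv0$). Suppose that the stability condition $$\frac{\Delta t_n}{h}\|v_h^n\|_\infty\le\frac m2$$ is satisfied at each step. Then $$\|v_h^n\|_\infty\le C\qquad\text{for } t_n\le T<T_1,$$ where $C$ is a constant depending on $T$ and $u_0$ (the parameters $m,q$ being fixed).
   Context: **Problem.** $m>0$, $0<q<1$; the Cauchy problem is $u_t-\frac1m u_x^2-u\,u_{xx}=m\,u^{q+1}$ on $\mathbb{R}\times(0,\infty)$, $u(\cdot,0)=u_0$. Norms $\|\cdot\|_s$ are those of $L^s(\mathbb{R})$. **Mesh and spaces.** Let $N\in\mathbb{N}$, $h=s_0/N$, $x_i=ih$ ($i\in\mathbb{Z}$), $I_i=(x_{i-1},x_i)$. Let $\Delta t_n>0$ be the time steps, $t_0=0$, $t_{n+1}=t_n+\Delta t_n$. At level $n$ there is an interval $[-s_-^n,s_+^n]$, with $s_\pm^0=s_0$; put $N_\pm^n=\lfloor s_\pm^n/h\rfloor$ and $h_\pm^n=s_\pm^n-(N_\pm^n-1)h$, so $h\le h_\pm^n<2h$. $V_h^n$ is the space of continuous functions on $\mathbb{R}$ that vanish outside $(-s_-^n,s_+^n)$ and are affine on each $I_i$, $-N_-^n+2\le i\le N_+^n-1$, and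 on the two end intervals $(-s_-^n,x_{-N_-^n+1})$ and $(x_{N_+^n-1},s_+^n)$. $\pi_h^n$ is Lagrange interpolation into $V_h^n$ at the nodes $x_i$, $-N_-^n+1\le i\le N_+^n-1$. Write $\phi_i=\phi_h(x_i)$. **Scheme.** $u_h^0=\pi_h^0u_0$. Given $u_h^n\in V_h^n$, its piecewise constant derivative $v_h^n$ is: $v_i^n=(u_i^n-u_{i-1}^n)/h$ on $I_i$ for $-N_-^n+2\le i\le N_+^n-1$, $v^n_{N_+^n}=-u^n_{N_+^n-1}/h_+^n$ on the right end interval, $v^n_{-N_-^n+1}=u^n_{-N_-^n+1}/h_-^n$ on the left end interval, and zero outside $(-s_-^n,s_+^n)$. (1) Hyperbolic step, for $u_t=\frac1m u_x^2$, solved exactly by the Hopf–Lax formula: $u^{n+1/2}(x)=\sup_{y\in\mathbb{R}}\{u_h^n(y)-\frac{m(x-y)^2}{4\Delta t_n}\}$; $s_+^{n+1}=s_+^n-\frac{\Delta t_n}{m}v^n_{N_+^n}$, $s_-^{n+1}=s_-^n+\frac{\Delta t_n}{m}v^n_{-N_-^n+1}$; $u_h^{n+1/2}=\pi_h^{n+1}u^{n+1/2}\in V_h^{n+1}$. (2) Parabolic step, for $u_t-u\,u_{xx}=mu^{q+1}$: $u_h^{n+1}\in V_h^{n+1}$ is the solution of, for all $\phi_h\in V_h^{n+1}$, $$(u_h^{n+1},\phi_h)_h+\Delta t_n\big((u_h^{n+1})_x,(u_h^{n+1/2}\phi_h)_x\big)=(u_h^{n+1/2},\phi_h)_h+mq\Delta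 t_n\big(\pi_h^{n+1}((u_h^{n+1/2})^qu_h^{n+1}),\phi_h\big)_h+m(1-q)\Delta t_n\big(\pi_h^{n+1}((u_h^{n+1/2})^{q+1}),\phi_h\big)_h,$$ where $(\cdot,\cdot)$ is the $L^2(\mathbb{R})$ scalar product and, with $a=-N_-^{n+1}+1$, $b=N_+^{n+1}-1$, $$(\phi_h,\psi_h)_h=\tfrac12(h_-^{n+1}+h)\phi_a\psi_a+h\sum_{i=a+1}^{b-1}\phi_i\psi_i+\tfrac12(h_+^{n+1}+h)\phi_b\psi_b .$$ Under the stability condition, this step has a unique solution, which is nonnegative, when $mq\Delta t_n\|u_h^{n+1/2}\|_\infty^q<1$; this holds automatically as long as $t_{n+1}<T_1$, because $\|u_h^{n+1/2}\|_\infty\le\|u_h^n\|_\infty\le\|u_h^0\|_\infty\,(1-mqt_n\|u_h^0\|_\infty^q)^{-1/q}$.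
   Formalization: C, uniform in h, is claimed for meshes with ‖v_h^0‖_∞ ≤ K and T < S ≤ T_1, and may depend on K and S: for u_0 continuous but not Lipschitz the uniform bound already fails at n = 0, and T_1 varies with h. For Lipschitz u_0, K can be its Lipschitz constant. *)

theory Defs
  imports "HOL-Analysis.Analysis" "HOL-Probability.Essential_Supremum"
begin

text \<open>The norm of \<open>L\<^sup>\<infinity>(\<real>)\<close>, with values in the extended reals.\<close>

definition Linf_norm :: "(real \<Rightarrow> real) \<Rightarrow> ereal" where
  "Linf_norm f = esssup lborel (\<lambda>x. ereal \<bar>f x\<bar>)"


text \<open>
  A mesh is given by \<open>h\<close>, \<open>sm\<close> (for \<open>s\<^sub>-\<close>) and \<open>sp\<close> (for \<open>s\<^sub>+\<close>). Its nodes are \<open>x\<^sub>i = i h\<close> with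
  \<open>-N\<^sub>- + 1 \<le> i \<le> N\<^sub>+ - 1\<close>. Its cells carry the indices \<open>-N\<^sub>- + 1 \<le> i \<le> N\<^sub>+\<close>: the first and the last
  one are the end intervals, the others are the intervals \<open>I\<^sub>i = (x\<^sub>i\<^sub>-\<^sub>1, x\<^sub>i)\<close>.
\<close>

definition Nend :: "real \<Rightarrow> real \<Rightarrow> int" where
  "Nend h s = \<lfloor>s / h\<rfloor>"

definition hend :: "real \<Rightarrow> real \<Rightarrow> real" where
  "hend h s = s - (of_int (Nend h s) - 1) * h"

definition first_node :: "real \<Rightarrow> real \<Rightarrow> int" where
  "first_node h sm = - Nend h sm + 1"

definition last_node :: "real \<Rightarrow> real \<Rightarrow> int" where
  "last_node h sp = Nend h sp - 1"

definition nodes :: "real \<Rightarrow> real \<Rightarrow> real \<Rightarrow> int set" where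
  "nodes h sm sp = {first_node h sm .. last_node h sp}"

definition cells :: "real \<Rightarrow> real \<Rightarrow> real \<Rightarrow> int set" where
  "cells h sm sp = {first_node h sm .. last_node h sp + 1}"

definition cell :: "real \<Rightarrow> real \<Rightarrow> real \<Rightarrow> int \<Rightarrow> real set" where
  "cell h sm sp i =
     {(if i = first_node h sm then - sm else of_int (i - 1) * h) <..<
      (if i = last_node h sp + 1 then sp else of_int i * h)}"

definition affine_fun_on :: "real set \<Rightarrow> (real \<Rightarrow> real) \<Rightarrow> bool" where
  "affine_fun_on S f \<longleftrightarrow> (\<exists>c d. \<forall>x\<in>S. f x = c * x + d)"

definition Vh :: "real \<Rightarrow> real \<Rightarrow> real \<Rightarrow> (real \<Rightarrow> real) set" where
  "Vh h sm sp = {f. continuous_on UNIV f \<and> (\<forall>x. x \<notin> {-sm<..<sp} \<longrightarrow> f x = 0) \<and>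
                    (\<forall>i\<in>cells h sm sp. affine_fun_on (cell h sm sp i) f)}"

definition lagrange :: "real \<Rightarrow> real \<Rightarrow> real \<Rightarrow> (real \<Rightarrow> real) \<Rightarrow> real \<Rightarrow> real" where
  "lagrange h sm sp f =
     (THE g. g \<in> Vh h sm sp \<and> (\<forall>i\<in>nodes h sm sp. g (of_int i * h) = f (of_int i * h)))"

text \<open>The interpolant exists and is unique, so \<open>THE\<close> is meaningful here.\<close>

lemma affine_fun_on_closed_interval:
  fixes f :: "real \<Rightarrow> real"
  assumes f: "continuous_on UNIV f" and "affine_fun_on {l<..<r} f" and "l < r"
  shows "affine_fun_on {l..r} f"
proof -
  obtain c d where cd: "\<And>x. x \<in> {l<..<r} \<Longrightarrow> f x = c * x + d"
    using assms(2) by (auto simp: affine_fun_on_def)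
  have cont: "continuous_on (closure {l<..<r}) (\<lambda>x. f x - c * x)"
    by (intro continuous_intros continuous_on_subset[OF f]) auto
  have "f x - c * x = d" if "x \<in> closure {l<..<r}" for x
    by (rule continuous_constant_on_closure[OF cont _ that]) (simp add: cd)
  then show ?thesis
    using \<open>l < r\<close> by (force simp: affine_fun_on_def algebra_simps)
qed

definition vertex :: "real \<Rightarrow> real \<Rightarrow> real \<Rightarrow> int \<Rightarrow> real" where
  "vertex h sm sp i =
     (if i < first_node h sm then - sm else if i > last_node h sp then sp else of_int i * h)"

lemma first_last_node:
  assumes "0 < h" "h \<le> sm" "h \<le> sp"
  shows "first_node h sm \<le> 0" "0 \<le> last_node h sp"
    "- sm < of_int (first_node h sm) * h" "of_int (last_node h sp) * h < sp"
proof -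
  have "1 \<le> sm / h" "1 \<le> sp / h"
    using assms by simp_all
  then show "first_node h sm \<le> 0" "0 \<le> last_node h sp"
    by (simp_all add: first_node_def last_node_def Nend_def le_floor_iff)
  have "of_int \<lfloor>sm / h\<rfloor> * h \<le> sm" "of_int \<lfloor>sp / h\<rfloor> * h \<le> sp"
    using assms(1) by (metis of_int_floor_le pos_le_divide_eq)+
  then show "- sm < of_int (first_node h sm) * h" "of_int (last_node h sp) * h < sp"
    using assms(1) by (simp_all add: first_node_def last_node_def Nend_def algebra_simps)
qed

lemma vertex_less:
  assumes "0 < h" "h \<le> sm" "h \<le> sp" "i \<in> cells h sm sp"
  shows "vertex h sm sp (i - 1) < vertex h sm sp i"
proof -
  note fl = first_last_node[OF assms(1-3)]
  have i: "first_node h sm \<le> i" "i \<le> last_node h sp + 1"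
    using assms(4) by (simp_all add: cells_def)
  consider "i = first_node h sm" | "i = last_node h sp + 1" "first_node h sm < i"
    | "first_node h sm < i" "i \<le> last_node h sp"
    using i by linarith
  then show ?thesis
    using fl assms(1) by cases (auto simp: vertex_def)
qed

lemma cell_vertex:
  assumes "0 < h" "h \<le> sm" "h \<le> sp" "i \<in> cells h sm sp"
  shows "cell h sm sp i = {vertex h sm sp (i - 1) <..< vertex h sm sp i}"
  using first_last_node[OF assms(1-3)] assms(4)
  by (auto simp: vertex_def cells_def cell_def)

lemma vertex_mono:
  assumes "0 < h" "h \<le> sm" "h \<le> sp" "i \<le> j" "first_node h sm - 1 \<le> i" "j \<le> last_node h sp + 1"
  shows "vertex h sm sp i \<le> vertex h sm sp j"
  using assms(4,6)
proof (induction j rule: int_ge_induct)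
  case base
  then show ?case by simp
next
  case (step j)
  have "j + 1 \<in> cells h sm sp"
    using step assms(5) by (simp add: cells_def)
  from vertex_less[OF assms(1-3) this] step show ?case by simp
qed

lemma cell_cover:
  assumes "0 < h" "h \<le> sm" "h \<le> sp" "x \<in> {-sm..sp}"
  obtains i where "i \<in> cells h sm sp" "vertex h sm sp (i - 1) \<le> x" "x \<le> vertex h sm sp i"
proof -
  let ?a = "first_node h sm" and ?v = "vertex h sm sp"
  note fl = first_last_node[OF assms(1-3)]
  have *: "\<exists>i\<in>{?a..j}. ?v (i - 1) \<le> x \<and> x \<le> ?v i" if "?a \<le> j" "x \<le> ?v j" for j
    using that
  proof (induction j rule: int_ge_induct)
    case base
    have "?v (?a - 1) = - sm" by (simp add: vertex_def)
    with base assms(4) show ?case by auto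
  next
    case (step j)
    show ?case
    proof (cases "x \<le> ?v j")
      case True
      with step show ?thesis by fastforce
    next
      case False
      with step show ?thesis by (intro bexI[of _ "j + 1"]) auto
    qed
  qed
  have "?v (last_node h sp + 1) = sp"
    using fl by (simp add: vertex_def)
  with *[of "last_node h sp + 1"] fl assms(4) that show ?thesis
    by (auto simp: cells_def)
qed

lemma lagrange_ex1:
  assumes "0 < h" "h \<le> sm" "h \<le> sp"
  shows "\<exists>!g. g \<in> Vh h sm sp \<and> (\<forall>i\<in>nodes h sm sp. g (of_int i * h) = f (of_int i * h))"
proof (rule ex_ex1I)
  let ?a = "first_node h sm" and ?b = "last_node h sp" and ?v = "vertex h sm sp"
  note fl = first_last_node[OF assms]
  define y where "y i = (if i \<in> nodes h sm sp then f (of_int i * h) else 0)" for i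
  define t where "t i x = (y i - y (i - 1)) / (?v i - ?v (i - 1)) *
      max 0 (min (x - ?v (i - 1)) (?v i - ?v (i - 1)))" for i x
  define g where "g x = (\<Sum>i\<in>{?a..?b+1}. t i x)" for x
  have y0: "y (?a - 1) = 0" "y (?b + 1) = 0"
    by (simp_all add: y_def nodes_def)
  have va: "?v (?a - 1) = - sm" and vb: "?v (?b + 1) = sp"
    using fl by (simp_all add: vertex_def)
  have less: "?v (i - 1) < ?v i" if "i \<in> {?a..?b+1}" for i
    using vertex_less[OF assms] that by (simp add: cells_def)
  have t_full: "t i x = y i - y (i - 1)" if "i \<in> {?a..?b+1}" "?v i \<le> x" for i x
    using less[OF that(1)] that(2) by (simp add: t_def)
  have t_zero: "t i x = 0" if "x \<le> ?v (i - 1)" for i x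
    using that by (simp add: t_def)
  have tele: "(\<Sum>i\<in>{?a..j}. y i - y (i - 1)) = y j" if "?a - 1 \<le> j" for j
    using that
  proof (induction j rule: int_ge_induct)
    case base
    then show ?case by (simp add: y0)
  next
    case (step j)
    have "{?a..j+1} = insert (j + 1) {?a..j}"
      using step by auto
    then show ?case
      using step by simp
  qed
  have g_cell: "g x = y (j - 1) + (y j - y (j - 1)) / (?v j - ?v (j - 1)) * (x - ?v (j - 1))"
    if j: "j \<in> {?a..?b+1}" and x: "?v (j - 1) \<le> x" "x \<le> ?v j" for j x
  proof -
    have split: "{?a..?b+1} = {?a..j-1} \<union> ({j} \<union> {j+1..?b+1})"
      using j by auto
    have "g x = (\<Sum>i\<in>{?a..j-1}. t i x) + (t j x + (\<Sum>i\<in>{j+1..?b+1}. t i x))"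
      unfolding g_def split by (subst sum.union_disjoint; simp)+
    also have "(\<Sum>i\<in>{?a..j-1}. t i x) = (\<Sum>i\<in>{?a..j-1}. y i - y (i - 1))"
    proof (rule sum.cong[OF refl])
      fix i assume i: "i \<in> {?a..j-1}"
      then have "?v i \<le> ?v (j - 1)"
        using j by (intro vertex_mono[OF assms]) auto
      with x i j show "t i x = y i - y (i - 1)"
        by (intro t_full) auto
    qed
    also have "\<dots> = y (j - 1)"
      using tele j by simp
    also have "(\<Sum>i\<in>{j+1..?b+1}. t i x) = 0"
    proof (rule sum.neutral, rule ballI)
      fix i assume i: "i \<in> {j+1..?b+1}"
      then have "?v j \<le> ?v (i - 1)"
        using j by (intro vertex_mono[OF assms]) auto
      with x show "t i x = 0"
        by (intro t_zero) auto
    qed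
    also have "t j x = (y j - y (j - 1)) / (?v j - ?v (j - 1)) * (x - ?v (j - 1))"
      using x less[OF j] by (simp add: t_def)
    finally show ?thesis by simp
  qed
  have cont: "continuous_on UNIV g"
    unfolding g_def t_def by (intro continuous_intros)
  have outside: "g x = 0" if "x \<notin> {-sm<..<sp}" for x
  proof (cases "x \<le> - sm")
    case True
    have "t i x = 0" if "i \<in> {?a..?b+1}" for i
    proof (rule t_zero)
      have "?v (?a - 1) \<le> ?v (i - 1)"
        using that by (intro vertex_mono[OF assms]) auto
      with True va show "x \<le> ?v (i - 1)" by simp
    qed
    then show ?thesis by (simp add: g_def)
  next
    case False
    with that have "sp \<le> x" by auto
    have "t i x = y i - y (i - 1)" if "i \<in> {?a..?b+1}" for i
    proof (rule t_full[OF that])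
      have "?v i \<le> ?v (?b + 1)"
        using that by (intro vertex_mono[OF assms]) auto
      with \<open>sp \<le> x\<close> vb show "?v i \<le> x" by simp
    qed
    then have "g x = (\<Sum>i\<in>{?a..?b+1}. y i - y (i - 1))"
      by (simp add: g_def)
    then show ?thesis
      using tele[of "?b + 1"] fl y0 by simp
  qed
  have aff: "affine_fun_on (cell h sm sp i) g" if "i \<in> cells h sm sp" for i
  proof -
    let ?s = "(y i - y (i - 1)) / (?v i - ?v (i - 1))"
    have "g x = ?s * x + (y (i - 1) - ?s * ?v (i - 1))" if "x \<in> cell h sm sp i" for x
      using g_cell[of i x] that cell_vertex[OF assms \<open>i \<in> cells h sm sp\<close>] \<open>i \<in> cells h sm sp\<close>
      by (simp add: cells_def right_diff_distrib)
    then show ?thesis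
      unfolding affine_fun_on_def by blast
  qed
  have node: "g (of_int i * h) = f (of_int i * h)" if "i \<in> nodes h sm sp" for i
  proof -
    have v: "?v i = of_int i * h"
      using that by (simp add: vertex_def nodes_def)
    have i: "i \<in> {?a..?b+1}"
      using that by (simp add: nodes_def)
    have "g (?v i) = y i"
      using g_cell[OF i, of "?v i"] less[OF i] by simp
    with v that show ?thesis by (simp add: y_def)
  qed
  show "\<exists>g. g \<in> Vh h sm sp \<and> (\<forall>i\<in>nodes h sm sp. g (of_int i * h) = f (of_int i * h))"
    using cont outside aff node by (intro exI[of _ g]) (simp add: Vh_def)
next
  let ?v = "vertex h sm sp"
  note fl = first_last_node[OF assms]
  fix g k
  assume g: "g \<in> Vh h sm sp \<and> (\<forall>i\<in>nodes h sm sp. g (of_int i * h) = f (of_int i * h))"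
    and k: "k \<in> Vh h sm sp \<and> (\<forall>i\<in>nodes h sm sp. k (of_int i * h) = f (of_int i * h))"
  have eqv: "g (?v i) = k (?v i)" for i
    using g k by (auto simp: vertex_def nodes_def Vh_def)
  show "g = k"
  proof
    fix x
    show "g x = k x"
    proof (cases "x \<in> {-sm..sp}")
      case False
      then have "x \<notin> {-sm<..<sp}" by auto
      then have "g x = 0" "k x = 0"
        using g k unfolding Vh_def by blast+
      then show ?thesis by simp
    next
      case True
      obtain i where i: "i \<in> cells h sm sp" "?v (i - 1) \<le> x" "x \<le> ?v i"
        using cell_cover[OF assms True] by blast
      note less = vertex_less[OF assms i(1)]
      have "affine_fun_on {?v (i - 1)..?v i} g" "affine_fun_on {?v (i - 1)..?v i} k"
        using g k i(1) less cell_vertex[OF assms i(1)]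
        by (auto intro!: affine_fun_on_closed_interval simp: Vh_def)
      then obtain c d c' d' where
        cd: "\<And>z. z \<in> {?v (i - 1)..?v i} \<Longrightarrow> g z = c * z + d"
            "\<And>z. z \<in> {?v (i - 1)..?v i} \<Longrightarrow> k z = c' * z + d'"
        unfolding affine_fun_on_def by metis
      have 1: "c * ?v (i - 1) + d = c' * ?v (i - 1) + d'" "c * ?v i + d = c' * ?v i + d'"
        using eqv[of "i - 1"] eqv[of i] cd[of "?v (i - 1)"] cd[of "?v i"] less by auto
      then have "(c - c') * (?v i - ?v (i - 1)) = 0"
        by (simp add: algebra_simps)
      with less have "c = c'" by simp
      with 1 have "d = d'" by simp
      with \<open>c = c'\<close> cd[of x] i show ?thesis by simp
    qed
  qed
qed

definition slope :: "real \<Rightarrow> real \<Rightarrow> real \<Rightarrow> (real \<Rightarrow> real) \<Rightarrow> int \<Rightarrow> real" where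
  "slope h sm sp f i =
     (if i = Nend h sp then - f (of_int (Nend h sp - 1) * h) / hend h sp
      else if i = - Nend h sm + 1 then f (of_int (- Nend h sm + 1) * h) / hend h sm
      else (f (of_int i * h) - f (of_int (i - 1) * h)) / h)"

text \<open>The piecewise constant derivative \<open>v\<^sub>h\<close>; its value \<open>0\<close> at the cell boundaries is immaterial.\<close>

definition vh :: "real \<Rightarrow> real \<Rightarrow> real \<Rightarrow> (real \<Rightarrow> real) \<Rightarrow> real \<Rightarrow> real" where
  "vh h sm sp f x = (\<Sum>i\<in>cells h sm sp. slope h sm sp f i * indicator (cell h sm sp i) x)"

definition lumped :: "real \<Rightarrow> real \<Rightarrow> real \<Rightarrow> (real \<Rightarrow> real) \<Rightarrow> (real \<Rightarrow> real) \<Rightarrow> real" where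
  "lumped h sm sp f g =
     (let a = first_node h sm; b = last_node h sp; fg = (\<lambda>i::int. f (of_int i * h) * g (of_int i * h))
      in (hend h sm + h) / 2 * fg a + h * (\<Sum>i\<in>{a+1..b-1}. fg i) + (hend h sp + h) / 2 * fg b)"

definition L2_inner :: "(real \<Rightarrow> real) \<Rightarrow> (real \<Rightarrow> real) \<Rightarrow> real" where
  "L2_inner f g = (LINT x|lborel. f x * g x)"


definition hopf_lax :: "real \<Rightarrow> real \<Rightarrow> (real \<Rightarrow> real) \<Rightarrow> real \<Rightarrow> real" where
  "hopf_lax m \<tau> f x = (SUP y. f y - m * (x - y)\<^sup>2 / (4 * \<tau>))"

text \<open>
  The derivatives below are those of piecewise smooth functions; \<open>deriv\<close> is unspecified at the
  finitely many kinks, which does not affect the integral. The values of \<open>w\<close> and \<open>u\<close> are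
  nonnegative, so \<open>powr\<close> is the usual power (with \<open>0 powr q = 0\<close>).
\<close>

definition parabolic_step ::
  "real \<Rightarrow> real \<Rightarrow> real \<Rightarrow> real \<Rightarrow> real \<Rightarrow> real \<Rightarrow> (real \<Rightarrow> real) \<Rightarrow> (real \<Rightarrow> real) \<Rightarrow> bool" where
  "parabolic_step m q \<tau> h sm sp w u \<longleftrightarrow> u \<in> Vh h sm sp \<and>
     (\<forall>\<phi>\<in>Vh h sm sp.
        lumped h sm sp u \<phi> + \<tau> * L2_inner (deriv u) (deriv (\<lambda>x. w x * \<phi> x)) =
        lumped h sm sp w \<phi>
        + m * q * \<tau> * lumped h sm sp (lagrange h sm sp (\<lambda>x. w x powr q * u x)) \<phi>
        + m * (1 - q) * \<tau> * lumped h sm sp (lagrange h sm sp (\<lambda>x. w x powr (q + 1))) \<phi>)"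

definition time :: "(nat \<Rightarrow> real) \<Rightarrow> nat \<Rightarrow> real" where
  "time dt n = (\<Sum>k<n. dt k)"

text \<open>
  The sequences \<open>sm\<close>, \<open>sp\<close>, \<open>u\<close> are the result of the first \<open>n\<close> steps of the scheme. The number of
  steps is finite because the parabolic step need not be solvable beyond the time \<open>T\<^sub>1\<close>.
\<close>

definition numerical_solution ::
  "real \<Rightarrow> real \<Rightarrow> real \<Rightarrow> (real \<Rightarrow> real) \<Rightarrow> real \<Rightarrow> (nat \<Rightarrow> real) \<Rightarrow> nat \<Rightarrow>
   (nat \<Rightarrow> real) \<Rightarrow> (nat \<Rightarrow> real) \<Rightarrow> (nat \<Rightarrow> real \<Rightarrow> real) \<Rightarrow> bool" where
  "numerical_solution m q s0 u0 h dt n sm sp u \<longleftrightarrow>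
     sm 0 = s0 \<and> sp 0 = s0 \<and> u 0 = lagrange h s0 s0 u0 \<and>
     (\<forall>k<n.
        sp (Suc k) = sp k - dt k / m * slope h (sm k) (sp k) (u k) (Nend h (sp k)) \<and>
        sm (Suc k) = sm k + dt k / m * slope h (sm k) (sp k) (u k) (- Nend h (sm k) + 1) \<and>
        parabolic_step m q (dt k) h (sm (Suc k)) (sp (Suc k))
          (lagrange h (sm (Suc k)) (sp (Suc k)) (hopf_lax m (dt k) (u k))) (u (Suc k)))"

definition stability_condition ::
  "real \<Rightarrow> real \<Rightarrow> (nat \<Rightarrow> real) \<Rightarrow> nat \<Rightarrow> (nat \<Rightarrow> real) \<Rightarrow> (nat \<Rightarrow> real) \<Rightarrow> (nat \<Rightarrow> real \<Rightarrow> real) \<Rightarrow> bool"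
  where
  "stability_condition m h dt n sm sp u \<longleftrightarrow>
     (\<forall>k<n. ereal (dt k / h) * Linf_norm (vh h (sm k) (sp k) (u k)) \<le> ereal (m / 2))"

definition T1 :: "real \<Rightarrow> real \<Rightarrow> (real \<Rightarrow> real) \<Rightarrow> ereal" where
  "T1 m q f = (if \<forall>x. f x = 0 then \<infinity>
               else ereal (1 / (m * q * real_of_ereal (Linf_norm f) powr q)))"

end

theory Submission
  imports Defs
begin

text \<open>
  Let \<open>w = u\<^sub>h\<^sup>n\<^sup>+\<^sup>1\<^sup>/\<^sup>2\<close>, \<open>U = u\<^sub>h\<^sup>n\<^sup>+\<^sup>1\<close>, and let \<open>\<sigma>\<close> be the slopes of \<open>U\<close>. The parabolic step
  at a node says that \<open>U\<^sub>i - G(w\<^sub>i)\<close> is a nonnegative multiple of \<open>\<sigma>\<^sub>i\<^sub>+\<^sub>1 - \<sigma>\<^sub>i\<close>, where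
  \<open>G(x) = x (1 + m \<Delta>t x\<^sup>q / (1 - m q \<Delta>t x\<^sup>q))\<close> is the result of the step without diffusion. In
  the cell where \<open>\<sigma>\<close> is maximal this yields \<open>U\<^sub>i - U\<^sub>i\<^sub>-\<^sub>1 \<le> G(w\<^sub>i) - G(w\<^sub>i\<^sub>-\<^sub>1)\<close>, and the reverse
  where it is minimal. So the largest slope grows at most by the Lipschitz constant
  \<open>1 + O(\<Delta>t)\<close> of \<open>G\<close>, with no smallness of \<open>\<Delta>t\<close>. The same comparison gives
  \<open>0 \<le> U \<le> G(max w)\<close>, whence \<open>m q M\<^sup>q (S - t) \<le> 1\<close> is preserved for an upper bound \<open>M\<close> of the
  solution at time \<open>t\<close>; this makes the \<open>O(\<Delta>t)\<close> uniform up to time \<open>T\<close>. The hyperbolic step does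
  not increase Lipschitz constants, and by the stability condition the Hopf--Lax solution
  vanishes at the new end points, which controls the slopes in the end cells.
\<close>

section \<open>The reaction map\<close>

text \<open>Because \<open>q < 1\<close>, \<open>x * y powr q \<le> x powr q * y\<close>. The factor
  \<open>x\<close> compensates the unbounded slope of the power at 0, which is why
  \<open>growth\<close> is Lipschitz down to 0.\<close>

lemma powr_chord_bound:
  fixes q x y :: real
  assumes "0 < q" "q < 1" "0 \<le> x" "x \<le> y"
  shows "x * (y powr q - x powr q) \<le> y powr q * (y - x)"
proof -
  have "x * y powr q = x powr q * y powr q * x powr (1 - q)"
    using assms by (cases "x = 0") (auto simp: powr_diff)
  also have "\<dots> \<le> x powr q * y powr q * y powr (1 - q)"
    using assms by (intro mult_left_mono powr_mono2) auto
  also have "\<dots> = x powr q * y"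
    using assms by (cases "y = 0") (auto simp: powr_diff)
  finally have "x * (y powr q - x powr q) \<le> x powr q * (y - x)"
    using assms powr_mult_base[of x q] by (simp add: algebra_simps)
  also have "\<dots> \<le> y powr q * (y - x)"
    using assms by (intro mult_right_mono powr_mono2) auto
  finally show ?thesis .
qed

text \<open>The solution \<open>U\<close> of
  \<open>U = x + m q \<tau> x^q U + m (1 - q) \<tau> x^(q+1)\<close>, that is, of the nodal equation
  when the two adjacent slopes agree.\<close>

definition growth :: "real \<Rightarrow> real \<Rightarrow> real \<Rightarrow> real \<Rightarrow> real" where
  "growth m q \<tau> x = x * (1 + m * \<tau> * x powr q / (1 - m * q * \<tau> * x powr q))"

lemma growth_0 [simp]: "growth m q \<tau> 0 = 0"
  by (simp add: growth_def)

text \<open>With \<open>F x = x powr q / (1 - m q \<tau> x powr q)\<close> the map is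
  \<open>x + m \<tau> x F x\<close>. The discrete product rule splits the increment of
  \<open>x F x\<close> into \<open>(y - x) F y\<close> and \<open>x (F y - F x)\<close>; both are
  nonnegative and at most \<open>(y - x) Y / \<delta>^2\<close>, whence the factor 2.\<close>

lemma growth_mono_lipschitz:
  fixes m q \<tau> x y Y \<delta> :: real
  assumes "0 < m" "0 < q" "q < 1" "0 < \<tau>" "0 \<le> x" "x \<le> y" "y powr q \<le> Y"
    and "0 < \<delta>" "\<delta> \<le> 1 - m * q * \<tau> * Y"
  shows "growth m q \<tau> x \<le> growth m q \<tau> y"
    and "growth m q \<tau> y - growth m q \<tau> x \<le> (1 + 2 * m * Y / \<delta>\<^sup>2 * \<tau>) * (y - x)"
proof -
  define A where "A = x powr q"
  define B where "B = y powr q"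
  define c where "c = m * q * \<tau>"
  have c: "0 < c" using assms by (simp add: c_def)
  have AB: "0 \<le> A" "A \<le> B" "B \<le> Y"
    using assms by (auto simp: A_def B_def intro: powr_mono2)
  have "c * A \<le> c * Y" "c * B \<le> c * Y"
    using AB c by (auto intro!: mult_left_mono)
  then have d: "\<delta> \<le> 1 - c * A" "\<delta> \<le> 1 - c * B"
    using assms(9) by (simp_all add: c_def)
  have "0 \<le> c * Y" using c AB by simp
  then have d1: "\<delta> \<le> 1" using assms(9) by (simp add: c_def)
  have ch: "x * (B - A) \<le> B * (y - x)"
    unfolding A_def B_def by (rule powr_chord_bound) (use assms in auto)
  have frac: "B / (1 - c * B) - A / (1 - c * A) = (B - A) / ((1 - c * A) * (1 - c * B))"
    using d assms(8) by (simp add: field_simps)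
  have fr0: "0 \<le> B / (1 - c * B) - A / (1 - c * A)"
    unfolding frac using d AB assms(8) by (intro divide_nonneg_nonneg mult_nonneg_nonneg) auto
  have B0: "0 \<le> B / (1 - c * B)" using d AB assms(8) by simp
  have eq: "growth m q \<tau> y - growth m q \<tau> x = (y - x) + m * \<tau> * ((y - x) * (B / (1 - c * B))
      + x * (B / (1 - c * B) - A / (1 - c * A)))"
  proof -
    have "growth m q \<tau> y = y * (1 + m * \<tau> * (B / (1 - c * B)))"
      "growth m q \<tau> x = x * (1 + m * \<tau> * (A / (1 - c * A)))"
      by (simp_all add: growth_def A_def B_def c_def)
    then show ?thesis by algebra
  qed
  have "0 \<le> (y - x) + m * \<tau> * ((y - x) * (B / (1 - c * B))
      + x * (B / (1 - c * B) - A / (1 - c * A)))"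
    using fr0 B0 assms by (intro add_nonneg_nonneg mult_nonneg_nonneg) auto
  with eq show "growth m q \<tau> x \<le> growth m q \<tau> y" by simp
  have dd: "\<delta>\<^sup>2 \<le> (1 - c * A) * (1 - c * B)"
    unfolding power2_eq_square using d assms(8) by (intro mult_mono) auto
  \<comment> \<open>The first summand has a single denominator; it is weakened to the square so that
    both summands share one constant.\<close>
  have d2: "\<delta>\<^sup>2 \<le> \<delta>"
    using d1 assms(8) by (simp add: power2_eq_square)
  have "B / (1 - c * B) \<le> Y / \<delta>\<^sup>2"
    using AB d d2 assms(8) by (intro frac_le) auto
  then have 1: "(y - x) * (B / (1 - c * B)) \<le> (y - x) * (Y / \<delta>\<^sup>2)"
    using assms by (intro mult_left_mono) auto
  have "x * ((B - A) / ((1 - c * A) * (1 - c * B))) = x * (B - A) / ((1 - c * A) * (1 - c * B))"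
    by simp
  also have "\<dots> \<le> B * (y - x) / \<delta>\<^sup>2"
    using ch dd assms AB by (intro frac_le) auto
  also have "\<dots> \<le> Y * (y - x) / \<delta>\<^sup>2"
    using AB assms by (intro divide_right_mono mult_right_mono) auto
  finally have 2: "x * (B / (1 - c * B) - A / (1 - c * A)) \<le> (y - x) * (Y / \<delta>\<^sup>2)"
    unfolding frac by (simp add: mult.commute)
  have "growth m q \<tau> y - growth m q \<tau> x \<le> (y - x) + m * \<tau> * ((y - x) * (Y / \<delta>\<^sup>2) + (y - x) * (Y / \<delta>\<^sup>2))"
    unfolding eq using assms by (intro add_left_mono mult_left_mono[OF add_mono[OF 1 2]]) auto
  also have "\<dots> = (1 + 2 * m * Y / \<delta>\<^sup>2 * \<tau>) * (y - x)"
    by (simp add: algebra_simps)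
  finally show "growth m q \<tau> y - growth m q \<tau> x \<le> (1 + 2 * m * Y / \<delta>\<^sup>2 * \<tau>) * (y - x)" .
qed

text \<open>Weighted AM-GM for \<open>1 + m (1 - q) \<tau> M\<^sup>q\<close> and \<open>1 - m q \<tau> M\<^sup>q\<close>, whose weighted mean is \<open>1\<close>.\<close>

lemma growth_powr_le:
  fixes m q \<tau> M :: real
  assumes "0 < m" "0 < q" "q < 1" "0 < \<tau>" "0 \<le> M" "m * q * \<tau> * M powr q < 1"
  shows "growth m q \<tau> M powr q * (1 - m * q * \<tau> * M powr q) \<le> M powr q"
proof -
  define Y where "Y = M powr q"
  define d where "d = 1 - m * q * \<tau> * Y"
  define e where "e = 1 + m * (1 - q) * \<tau> * Y"
  have Y: "0 \<le> Y" by (simp add: Y_def)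
  have d: "0 < d" using assms by (simp add: d_def Y_def)
  have e: "0 < e"
    unfolding e_def using assms Y by (intro add_pos_nonneg) auto
  have "1 + m * \<tau> * Y / d = e / d"
    using d by (simp add: field_simps) (simp add: d_def e_def algebra_simps)
  then have g: "growth m q \<tau> M = M * (e / d)"
    by (simp add: growth_def Y_def d_def)
  have "growth m q \<tau> M powr q * d = Y * (e powr q * d powr (1 - q))"
    unfolding g using assms e d by (simp add: powr_mult powr_divide powr_diff Y_def)
  also have "e powr q * d powr (1 - q) \<le> q * e + (1 - q) * d"
    using assms e d by (intro Youngs_inequality_0) auto
  also have "q * e + (1 - q) * d = 1"
    by (simp add: e_def d_def algebra_simps)
  finally show ?thesis
    using Y by (simp add: mult_left_mono d_def Y_def)
qed

section \<open>Functions on a mesh\<close>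

lemma finite_argmax:
  fixes f :: "'a \<Rightarrow> real"
  assumes "finite A" "A \<noteq> {}"
  obtains i where "i \<in> A" "\<And>j. j \<in> A \<Longrightarrow> f j \<le> f i"
proof -
  have "Max (f ` A) \<in> f ` A" using assms by simp
  then obtain i where "i \<in> A" "Max (f ` A) = f i" by auto
  then show ?thesis using Max_ge[of "f ` A"] assms(1) that by fastforce
qed

lemma finite_argmin:
  fixes f :: "'a \<Rightarrow> real"
  assumes "finite A" "A \<noteq> {}"
  obtains i where "i \<in> A" "\<And>j. j \<in> A \<Longrightarrow> f i \<le> f j"
  using finite_argmax[OF assms, of "\<lambda>x. - f x"] by auto

text \<open>Instantiated anew at each time level. The two inequalities guarantee that 0 is a node,
  and they persist because the end points only move outwards.\<close>

locale mesh =
  fixes h sm sp :: real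
  assumes h_pos: "0 < h" and h_le_sm: "h \<le> sm" and h_le_sp: "h \<le> sp"
begin

abbreviation a :: int where "a \<equiv> first_node h sm"
abbreviation b :: int where "b \<equiv> last_node h sp"
abbreviation X :: "int \<Rightarrow> real" where "X \<equiv> vertex h sm sp"
abbreviation \<sigma> :: "(real \<Rightarrow> real) \<Rightarrow> int \<Rightarrow> real" where "\<sigma> \<equiv> slope h sm sp"

lemmas mesh_bounds = h_pos h_le_sm h_le_sp
lemmas first_last = first_last_node[OF mesh_bounds]

lemma cells_iff: "i \<in> cells h sm sp \<longleftrightarrow> a \<le> i \<and> i \<le> b + 1"
  by (auto simp: cells_def)

lemma nodes_iff: "i \<in> nodes h sm sp \<longleftrightarrow> a \<le> i \<and> i \<le> b"
  by (auto simp: nodes_def)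

lemma X_first: "X (a - 1) = - sm"
  by (simp add: vertex_def)

lemma X_last: "X (b + 1) = sp"
  using first_last by (simp add: vertex_def)

lemma X_node: "i \<in> nodes h sm sp \<Longrightarrow> X i = of_int i * h"
  by (simp add: vertex_def nodes_iff)

lemma X_less: "i \<in> cells h sm sp \<Longrightarrow> X (i - 1) < X i"
  by (rule vertex_less[OF mesh_bounds])

lemma X_le: "a - 1 \<le> i \<Longrightarrow> i \<le> j \<Longrightarrow> j \<le> b + 1 \<Longrightarrow> X i \<le> X j"
  by (rule vertex_mono[OF mesh_bounds])

lemma cell_eq: "i \<in> cells h sm sp \<Longrightarrow> cell h sm sp i = {X (i - 1)<..<X i}"
  by (rule cell_vertex[OF mesh_bounds])

lemma cell_length_last: "hend h sp = X (b + 1) - X b" and cell_length_first: "hend h sm = X a - X (a - 1)"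
  using first_last by (auto simp: vertex_def hend_def last_node_def first_node_def algebra_simps)

text \<open>The end cells reach to the last node but one inside the support, so they are not shorter
  than the others. This lower bound is what the stability condition is played against at the end
  points.\<close>

lemma cell_length_ge: "i \<in> cells h sm sp \<Longrightarrow> h \<le> X i - X (i - 1)"
proof -
  assume i: "i \<in> cells h sm sp"
  have "of_int \<lfloor>sm / h\<rfloor> * h \<le> sm" "of_int \<lfloor>sp / h\<rfloor> * h \<le> sp"
    using h_pos by (metis of_int_floor_le pos_le_divide_eq)+
  then have ends: "h \<le> hend h sm" "h \<le> hend h sp"
    by (auto simp: hend_def Nend_def algebra_simps)
  consider "i = a" | "i = b + 1" | "a < i" "i \<le> b"
    using i unfolding cells_iff by linarith
  then show ?thesis
  proof cases
    case 3
    then show ?thesis by (simp add: vertex_def algebra_simps)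
  qed (use cell_length_first cell_length_last ends in auto)
qed

section \<open>Piecewise affine functions: slopes, bounds, Lipschitz constants\<close>

lemma Vh_outside: "f \<in> Vh h sm sp \<Longrightarrow> x \<notin> {-sm<..<sp} \<Longrightarrow> f x = 0"
  unfolding Vh_def by blast

lemma Vh_ends:
  assumes "f \<in> Vh h sm sp"
  shows "f (X (a - 1)) = 0" "f (X (b + 1)) = 0"
  using Vh_outside[OF assms] by (simp_all add: X_first X_last)

text \<open>Since the end values vanish, the three cases of \<open>slope\<close> are one and the
  same difference quotient between consecutive vertices. Later arguments then treat end cells and
  inner cells alike.\<close>

lemma slope_eq:
  assumes f: "f \<in> Vh h sm sp" and i: "i \<in> cells h sm sp"
  shows "\<sigma> f i = (f (X i) - f (X (i - 1))) / (X i - X (i - 1))"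
proof -
  note fl = first_last
  consider "i = b + 1" | "i = a" | "a < i" "i \<le> b"
    using i unfolding cells_iff by linarith
  then show ?thesis
  proof cases
    case 1
    then have "i = Nend h sp" by (simp add: last_node_def)
    then have "\<sigma> f i = - f (of_int b * h) / hend h sp"
      by (simp add: slope_def last_node_def)
    moreover have "X b = of_int b * h" using fl by (simp add: X_node nodes_iff)
    ultimately show ?thesis
      using 1 cell_length_last Vh_ends[OF f] by simp
  next
    case 2
    \<comment> \<open>\<open>slope\<close> tests for the right end cell first;
      \<open>a \<le> b\<close> keeps the first cell from being caught by that test.\<close>
    then have "i \<noteq> Nend h sp" "i = - Nend h sm + 1"
      using fl by (auto simp: last_node_def first_node_def)
    then have "\<sigma> f i = f (of_int a * h) / hend h sm"
      by (simp add: slope_def first_node_def)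
    moreover have "X a = of_int a * h" using fl by (simp add: X_node nodes_iff)
    ultimately show ?thesis
      using 2 cell_length_first Vh_ends[OF f] by simp
  next
    case 3
    then have "i \<noteq> Nend h sp" "i \<noteq> - Nend h sm + 1"
      by (auto simp: last_node_def first_node_def)
    then show ?thesis
      using 3 by (simp add: slope_def X_node nodes_iff algebra_simps)
  qed
qed

lemma slope_mult:
  assumes "f \<in> Vh h sm sp" "i \<in> cells h sm sp"
  shows "\<sigma> f i * (X i - X (i - 1)) = f (X i) - f (X (i - 1))"
  using slope_eq[OF assms] X_less[OF assms(2)] by simp

lemma Vh_cell_affine:
  assumes f: "f \<in> Vh h sm sp" and i: "i \<in> cells h sm sp" and x: "x \<in> {X (i - 1)..X i}"
  shows "f x = f (X (i - 1)) + \<sigma> f i * (x - X (i - 1))"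
proof -
  note less = X_less[OF i]
  have "affine_fun_on {X (i - 1)..X i} f"
    using f i less cell_eq[OF i] by (auto intro!: affine_fun_on_closed_interval simp: Vh_def)
  then obtain c d where cd: "\<And>x. x \<in> {X (i - 1)..X i} \<Longrightarrow> f x = c * x + d"
    unfolding affine_fun_on_def by auto
  then have v: "f (X i) = c * X i + d" "f (X (i - 1)) = c * X (i - 1) + d"
    using less by auto
  have "f (X i) - f (X (i - 1)) = c * (X i - X (i - 1))"
    using v by (simp add: algebra_simps)
  then have "\<sigma> f i = c"
    using slope_eq[OF f i] less by simp
  then show ?thesis using cd[OF x] v by (simp add: algebra_simps)
qed

text \<open>On a cell the function is a convex combination of its two vertex values, and the end
  vertices carry the value 0, which lies in the range by \<open>0 \<le> M\<close>.\<close>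

lemma Vh_nonneg_le:
  assumes f: "f \<in> Vh h sm sp" and "0 \<le> M"
    and *: "\<And>i. i \<in> nodes h sm sp \<Longrightarrow> 0 \<le> f (X i) \<and> f (X i) \<le> M"
  shows "0 \<le> f x \<and> f x \<le> M"
proof (cases "x \<in> {-sm..sp}")
  case False
  then have "f x = 0" using Vh_outside[OF f] by auto
  with assms(2) show ?thesis by simp
next
  case True
  have v: "0 \<le> f (X i) \<and> f (X i) \<le> M" if "a - 1 \<le> i" "i \<le> b + 1" for i
  proof -
    have "i \<in> nodes h sm sp \<or> i = a - 1 \<or> i = b + 1" using that by (auto simp: nodes_iff)
    then show ?thesis using * Vh_ends[OF f] assms(2) by auto
  qed
  obtain i where i: "i \<in> cells h sm sp" "X (i - 1) \<le> x" "x \<le> X i"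
    using cell_cover[OF mesh_bounds True] by blast
  note less = X_less[OF i(1)]
  define t where "t = (x - X (i - 1)) / (X i - X (i - 1))"
  have t: "0 \<le> t" "t \<le> 1" using i less by (auto simp: t_def)
  have "f x = (1 - t) * f (X (i - 1)) + t * f (X i)"
    using Vh_cell_affine[OF f i(1), of x] slope_eq[OF f i(1)] i
    by (simp add: t_def algebra_simps diff_divide_distrib)
  moreover have "0 \<le> (1 - t) * f (X (i - 1)) + t * f (X i)"
    using t v[of "i - 1"] v[of i] i(1) by (intro add_nonneg_nonneg mult_nonneg_nonneg) (auto simp: cells_iff)
  moreover have "(1 - t) * f (X (i - 1)) + t * f (X i) \<le> (1 - t) * M + t * M"
    using t v[of "i - 1"] v[of i] i(1) by (intro add_mono mult_left_mono) (auto simp: cells_iff)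
  ultimately show ?thesis by (simp add: algebra_simps)
qed

text \<open>A Lipschitz constant valid on finitely many closed pieces is valid on an interval that
  they cover; the pieces are the closed cells and the two outer half-lines.\<close>

lemma Vh_lipschitz:
  assumes f: "f \<in> Vh h sm sp" and V: "0 \<le> V" "\<And>i. i \<in> cells h sm sp \<Longrightarrow> \<bar>\<sigma> f i\<bar> \<le> V"
  shows "\<bar>f x - f y\<bar> \<le> V * \<bar>x - y\<bar>"
proof -
  \<comment> \<open>Indices 0 and 1 are reserved for the half-lines; the cell with index
    \<open>j\<close> becomes piece \<open>j - a + 2\<close>.\<close>
  define U where "U i = (if i = 0 then {..-sm} else if i = 1 then {sp..}
    else {X (i + a - 3)..X (i + a - 2)})" for i :: int
  let ?I = "{0..b - a + 3}"
  have "V-lipschitz_on {min x y..max x y} f"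
  proof (rule lipschitz_on_closed_Union[where U = U and I = ?I])
    show "V-lipschitz_on (U i) f" if "i \<in> ?I" for i
    proof -
      have "i = 0 \<or> i = 1 \<or> i + a - 2 \<in> cells h sm sp \<and> 2 \<le> i"
        using that by (auto simp: cells_iff)
      then consider "i = 0 \<or> i = 1" | "i + a - 2 \<in> cells h sm sp" "2 \<le> i"
        by blast
      then show ?thesis
      proof cases
        case 1
        then have "f z = 0" if "z \<in> U i" for z
          using Vh_outside[OF f, of z] that by (auto simp: U_def split: if_splits)
        then show ?thesis
          using V(1) by (auto intro!: lipschitz_onI)
      next
        case 2
        let ?j = "i + a - 2"
        have U: "U i = {X (?j - 1)..X ?j}" using 2 by (simp add: U_def algebra_simps)
        show ?thesis
        proof (rule lipschitz_onI)
          fix u v assume "u \<in> U i" "v \<in> U i"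
          then have "f u - f v = \<sigma> f ?j * (u - v)"
            unfolding U using Vh_cell_affine[OF f 2(1), of u] Vh_cell_affine[OF f 2(1), of v]
            by (simp add: algebra_simps)
          then show "dist (f u) (f v) \<le> V * dist u v"
            using V(2)[OF 2(1)] by (simp add: dist_real_def abs_mult mult_right_mono)
        qed (rule V)
      qed
    qed
    show "closed (U i)" for i by (simp add: U_def)
    show "{min x y..max x y} \<subseteq> \<Union> (U ` ?I)"
    proof
      fix z
      consider "z \<le> -sm" | "sp \<le> z" | "z \<in> {-sm..sp}" unfolding atLeastAtMost_iff by linarith
      then show "z \<in> \<Union> (U ` ?I)"
      proof cases
        case 1
        then have "z \<in> U 0" "0 \<in> ?I" using first_last by (auto simp: U_def)
        then show ?thesis by blast
      next
        case 2
        then have "z \<in> U 1" "1 \<in> ?I" using first_last by (auto simp: U_def)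
        then show ?thesis by blast
      next
        case 3
        obtain i where i: "i \<in> cells h sm sp" "X (i - 1) \<le> z" "z \<le> X i"
          using cell_cover[OF mesh_bounds 3] by blast
        then have "z \<in> U (i - a + 2)" "i - a + 2 \<in> ?I"
          by (auto simp: U_def cells_iff algebra_simps)
        then show ?thesis by blast
      qed
    qed
  qed (use V in auto)
  then have "dist (f x) (f y) \<le> V * dist x y"
    by (rule lipschitz_onD) auto
  then show ?thesis by (simp add: dist_real_def)
qed

section \<open>Interpolation and the norm of the discrete derivative\<close>

lemma lagrange_spec:
  "lagrange h sm sp f \<in> Vh h sm sp"
  "i \<in> nodes h sm sp \<Longrightarrow> lagrange h sm sp f (X i) = f (X i)"
  using theI'[OF lagrange_ex1[OF mesh_bounds, of f]] by (auto simp: lagrange_def X_node)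

text \<open>Cells are disjoint and have positive measure, so an essential bound is a bound on every
  slope. This turns the norms of the theorem into finitely many inequalities.\<close>

lemma Linf_norm_vh_le_iff:
  "Linf_norm (vh h sm sp f) \<le> ereal C \<longleftrightarrow> (\<forall>i\<in>cells h sm sp. \<bar>\<sigma> f i\<bar> \<le> C)"
proof
  have fin: "finite (cells h sm sp)" by (simp add: cells_def)
  have vh_cell: "vh h sm sp f x = \<sigma> f i" if i: "i \<in> cells h sm sp" and x: "x \<in> cell h sm sp i" for i x
  proof -
    have "x \<notin> cell h sm sp j" if j: "j \<in> cells h sm sp" "j \<noteq> i" for j
    proof (cases "j < i")
      case True
      then have "X j \<le> X (i - 1)" using i j by (intro X_le) (auto simp: cells_iff)
      then show ?thesis using x cell_eq[OF i] cell_eq[OF j(1)] by auto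
    next
      case False
      then have "X i \<le> X (j - 1)" using i j by (intro X_le) (auto simp: cells_iff)
      then show ?thesis using x cell_eq[OF i] cell_eq[OF j(1)] by auto
    qed
    then have "vh h sm sp f x = (\<Sum>j\<in>cells h sm sp. if j = i then \<sigma> f i else 0)"
      unfolding vh_def by (intro sum.cong) (use x in auto)
    then show ?thesis using fin i by simp
  qed
  {
    assume L: "Linf_norm (vh h sm sp f) \<le> ereal C"
    show "\<forall>i\<in>cells h sm sp. \<bar>\<sigma> f i\<bar> \<le> C"
    proof
      fix i assume i: "i \<in> cells h sm sp"
      have "AE x in lborel. ereal \<bar>vh h sm sp f x\<bar> \<le> ereal C"
        using esssup_AE[of "\<lambda>x. ereal \<bar>vh h sm sp f x\<bar>" lborel]
        by eventually_elim (rule order_trans[OF _ L[unfolded Linf_norm_def]])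
      then have "AE x in lborel. x \<in> cell h sm sp i \<longrightarrow> \<bar>\<sigma> f i\<bar> \<le> C"
        by eventually_elim (use vh_cell[OF i] in auto)
      moreover have "\<not> (AE x in lborel. x \<notin> cell h sm sp i)"
      proof
        assume "AE x in lborel. x \<notin> cell h sm sp i"
        then have "emeasure lborel (cell h sm sp i) = 0"
          using AE_iff_null_sets[of "cell h sm sp i" lborel] by (auto simp: cell_def null_sets_def)
        then show False using X_less[OF i] cell_eq[OF i] by simp
      qed
      ultimately show "\<bar>\<sigma> f i\<bar> \<le> C" by (cases "\<bar>\<sigma> f i\<bar> \<le> C") auto
    qed
  next
    assume C: "\<forall>i\<in>cells h sm sp. \<bar>\<sigma> f i\<bar> \<le> C"
    \<comment> \<open>A cell exists, so \<open>C\<close> is nonnegative; this is needed off the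
      cells, where \<open>vh\<close> is 0.\<close>
    have "a \<in> cells h sm sp" using first_last by (simp add: cells_iff)
    then have C0: "0 \<le> C" using C by force
    have "\<bar>vh h sm sp f x\<bar> \<le> C" for x
    proof (cases "\<exists>i\<in>cells h sm sp. x \<in> cell h sm sp i")
      case True
      then show ?thesis using vh_cell C by metis
    next
      case False
      then show ?thesis using C0 by (simp add: vh_def sum.neutral)
    qed
    moreover have "(\<lambda>x. ereal \<bar>vh h sm sp f x\<bar>) \<in> borel_measurable lborel"
      unfolding vh_def cell_def by measurable
    ultimately show "Linf_norm (vh h sm sp f) \<le> ereal C"
      unfolding Linf_norm_def by (intro esssup_I) auto
  }
qed

section \<open>The parabolic step\<close>

lemma DERIV_Vh:
  assumes f: "f \<in> Vh h sm sp" and i: "i \<in> cells h sm sp" and x: "x \<in> {X (i - 1)<..<X i}"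
  shows "(f has_real_derivative \<sigma> f i) (at x)"
proof (rule has_field_derivative_transform_within_open[OF _ _ x])
  show "((\<lambda>x. f (X (i - 1)) + \<sigma> f i * (x - X (i - 1))) has_real_derivative \<sigma> f i) (at x)"
    by (auto intro!: derivative_eq_intros)
  show "f (X (i - 1)) + \<sigma> f i * (y - X (i - 1)) = f y" if "y \<in> {X (i - 1)<..<X i}" for y
    by (rule Vh_cell_affine[OF f i, symmetric]) (use that in auto)
qed auto

lemma DERIV_Vh_outside:
  assumes f: "f \<in> Vh h sm sp" and x: "x \<notin> {-sm..sp}"
  shows "(f has_real_derivative 0) (at x)"
proof (rule has_field_derivative_transform_within_open[where f = "\<lambda>_. 0" and S = "- {-sm..sp}"])
  show "0 = f y" if "y \<in> - {-sm..sp}" for y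
    using Vh_outside[OF f, of y] that by auto
qed (use x in \<open>auto intro: derivative_eq_intros\<close>)

text \<open>The derivative of \<open>u\<close> is constant on each cell, so the fundamental theorem
  leaves only the increments of \<open>w * \<phi>\<close> over the cells.\<close>

lemma L2_inner_deriv:
  assumes u: "u \<in> Vh h sm sp" and w: "w \<in> Vh h sm sp" and \<phi>: "\<phi> \<in> Vh h sm sp"
  shows "L2_inner (deriv u) (deriv (\<lambda>x. w x * \<phi> x)) =
    (\<Sum>i\<in>cells h sm sp. \<sigma> u i * (w (X i) * \<phi> (X i) - w (X (i - 1)) * \<phi> (X (i - 1))))"
proof -
  \<comment> \<open>The affine pieces are extended to the whole line, so that two-sided derivatives
    exist also at the ends of the cell.\<close>
  define wl where "wl i x = w (X (i - 1)) + \<sigma> w i * (x - X (i - 1))" for i x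
  define \<phi>l where "\<phi>l i x = \<phi> (X (i - 1)) + \<sigma> \<phi> i * (x - X (i - 1))" for i x
  define D where "D i x = \<sigma> w i * \<phi>l i x + wl i x * \<sigma> \<phi> i" for i x
  define g where "g x = (\<Sum>i\<in>cells h sm sp. \<sigma> u i * (D i x * indicator {X (i - 1)..X i} x))" for x
  have fin: "finite (cells h sm sp)" by (simp add: cells_def)
  have int: "has_bochner_integral lborel (\<lambda>x. D i x * indicator {X (i - 1)..X i} x)
      (w (X i) * \<phi> (X i) - w (X (i - 1)) * \<phi> (X (i - 1)))" if i: "i \<in> cells h sm sp" for i
  proof -
    have "has_bochner_integral lborel (\<lambda>x. D i x * indicator {X (i - 1)..X i} x)
        (wl i (X i) * \<phi>l i (X i) - wl i (X (i - 1)) * \<phi>l i (X (i - 1)))"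
    proof (rule has_bochner_integral_FTC_Icc_real)
      show "X (i - 1) \<le> X i" using X_less[OF i] by simp
      show "((\<lambda>x. wl i x * \<phi>l i x) has_real_derivative D i x) (at x)" for x
        unfolding wl_def \<phi>l_def D_def
        by (auto intro!: derivative_eq_intros simp: algebra_simps)
      show "isCont (D i) x" for x
        unfolding wl_def \<phi>l_def D_def by (intro continuous_intros)
    qed
    then show ?thesis
      using slope_mult[OF w i] slope_mult[OF \<phi> i] by (simp add: wl_def \<phi>l_def)
  qed
  have "has_bochner_integral lborel g
      (\<Sum>i\<in>cells h sm sp. \<sigma> u i * (w (X i) * \<phi> (X i) - w (X (i - 1)) * \<phi> (X (i - 1))))"
    unfolding g_def by (intro has_bochner_integral_sum has_bochner_integral_mult_right int)
  \<comment> \<open>The integrands may differ only at the vertices, a finite set.\<close>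
  moreover have "integral\<^sup>L lborel (\<lambda>x. deriv u x * deriv (\<lambda>x. w x * \<phi> x) x) = integral\<^sup>L lborel g"
  proof (rule integral_discrete_difference[where X = "X ` {a - 1..b + 1}"])
    fix x assume x: "x \<notin> X ` {a - 1..b + 1}"
    show "deriv u x * deriv (\<lambda>x. w x * \<phi> x) x = g x"
    proof (cases "x \<in> {-sm..sp}")
      case False
      have "x \<notin> {X (i - 1)..X i}" if "i \<in> cells h sm sp" for i
        using False X_le[of "a - 1" "i - 1"] X_le[of i "b + 1"] that X_first X_last
        by (auto simp: cells_iff)
      then have "g x = 0" by (simp add: g_def sum.neutral)
      moreover have "deriv u x = 0"
        by (rule DERIV_imp_deriv[OF DERIV_Vh_outside[OF u False]])
      ultimately show ?thesis by simp
    next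
      case True
      obtain i where i: "i \<in> cells h sm sp" "X (i - 1) \<le> x" "x \<le> X i"
        using cell_cover[OF mesh_bounds True] by blast
      have "x \<noteq> X (i - 1)" "x \<noteq> X i"
        using x i(1) by (auto simp: cells_iff)
      with i have xi: "x \<in> {X (i - 1)<..<X i}" by auto
      have other: "x \<notin> {X (j - 1)..X j}" if j: "j \<in> cells h sm sp" "j \<noteq> i" for j
      proof (cases "j < i")
        case True
        then have "X j \<le> X (i - 1)" using i j by (intro X_le) (auto simp: cells_iff)
        then show ?thesis using xi by auto
      next
        case False
        then have "X i \<le> X (j - 1)" using i j by (intro X_le) (auto simp: cells_iff)
        then show ?thesis using xi by auto
      qed
      have "g x = (\<Sum>j\<in>cells h sm sp. if j = i then \<sigma> u i * D i x else 0)"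
        unfolding g_def using other xi by (intro sum.cong) auto
      then have "g x = \<sigma> u i * D i x" using fin i by simp
      moreover have "deriv u x = \<sigma> u i"
        by (rule DERIV_imp_deriv[OF DERIV_Vh[OF u i(1) xi]])
      moreover have "w x = wl i x" "\<phi> x = \<phi>l i x"
        using Vh_cell_affine[OF w i(1), of x] Vh_cell_affine[OF \<phi> i(1), of x] i
        by (auto simp: wl_def \<phi>l_def)
      then have "deriv (\<lambda>x. w x * \<phi> x) x = D i x"
        using DERIV_mult[OF DERIV_Vh[OF w i(1) xi] DERIV_Vh[OF \<phi> i(1) xi]]
        by (intro DERIV_imp_deriv) (simp add: D_def mult.commute)
      ultimately show ?thesis by simp
    qed
  qed auto
  ultimately show ?thesis
    by (simp add: L2_inner_def has_bochner_integral_integral_eq)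
qed

section \<open>The scheme at a single node\<close>

text \<open>If \<open>a = b\<close>, both end terms of the lumped product belong to the same node.\<close>

definition node_mass :: "int \<Rightarrow> real" where
  "node_mass i = (if i = a then (hend h sm + h) / 2 else 0) + (if a < i \<and> i < b then h else 0) +
     (if i = b then (hend h sp + h) / 2 else 0)"

lemma node_mass_pos:
  assumes "i \<in> nodes h sm sp"
  shows "0 < node_mass i"
proof -
  have "a \<in> cells h sm sp" "b + 1 \<in> cells h sm sp"
    using first_last by (auto simp: cells_iff)
  from this[THEN cell_length_ge] have "h \<le> hend h sm" "h \<le> hend h sp"
    by (simp_all add: cell_length_first cell_length_last)
  then have "0 < (hend h sm + h) / 2" "0 < (hend h sp + h) / 2"
    using h_pos by auto
  then show ?thesis
    using h_pos assms by (auto simp: node_mass_def nodes_iff intro: add_pos_pos)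
qed

lemma lumped_hat:
  assumes i: "i \<in> nodes h sm sp"
    and \<phi>: "\<And>j. j \<in> nodes h sm sp \<Longrightarrow> \<phi> (X j) = (if j = i then 1 else 0)"
  shows "lumped h sm sp f \<phi> = node_mass i * f (X i)"
proof -
  have \<phi>': "\<phi> (of_int j * h) = (if j = i then 1 else 0)" if "a \<le> j" "j \<le> b" for j
    using \<phi>[of j] X_node[of j] that by (simp add: nodes_iff)
  have "(\<Sum>j\<in>{a + 1..b - 1}. f (of_int j * h) * \<phi> (of_int j * h)) =
      (\<Sum>j\<in>{a + 1..b - 1}. if j = i then f (X i) else 0)"
    using X_node[OF i] by (intro sum.cong) (auto simp: \<phi>')
  then have "(\<Sum>j\<in>{a + 1..b - 1}. f (of_int j * h) * \<phi> (of_int j * h)) =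
      (if a < i \<and> i < b then f (X i) else 0)"
    by auto
  moreover have "\<phi> (of_int a * h) = (if a = i then 1 else 0)" "\<phi> (of_int b * h) = (if b = i then 1 else 0)"
    using first_last by (simp_all add: \<phi>')
  ultimately show ?thesis
    using X_node[OF i] i by (auto simp: lumped_def Let_def node_mass_def nodes_iff distrib_right)
qed

text \<open>The scheme is tested with the hat function of node \<open>i\<close>. Mass lumping
  isolates the nodal value, and in the diffusion term only the cells \<open>i\<close> and
  \<open>i + 1\<close> contribute, with increments \<open>w (X i)\<close> and
  \<open>- w (X i)\<close>.\<close>

lemma parabolic_step_node:
  assumes step: "parabolic_step m q \<tau> h sm sp w u" and w: "w \<in> Vh h sm sp"
    and i: "i \<in> nodes h sm sp"
  shows "node_mass i * u (X i) + \<tau> * (w (X i) * (\<sigma> u i - \<sigma> u (i + 1))) = node_mass i *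
    (w (X i) + m * q * \<tau> * (w (X i) powr q * u (X i)) + m * (1 - q) * \<tau> * w (X i) powr (q + 1))"
proof -
  define \<phi> where "\<phi> = lagrange h sm sp (\<lambda>x. if x = X i then 1 else 0)"
  have \<phi>: "\<phi> \<in> Vh h sm sp" by (simp add: \<phi>_def lagrange_spec)
  have hat: "\<phi> (X j) = (if j = i then 1 else 0)" if "j \<in> nodes h sm sp" for j
  proof -
    have "X j = X i \<longleftrightarrow> j = i" using that i h_pos by (simp add: X_node)
    then show ?thesis by (simp add: \<phi>_def lagrange_spec(2)[OF that])
  qed
  have hat': "\<phi> (X j) = (if j = i then 1 else 0)" if "a - 1 \<le> j" "j \<le> b + 1" for j
  proof -
    have "j \<in> nodes h sm sp \<or> j = a - 1 \<or> j = b + 1" using that by (auto simp: nodes_iff)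
    then show ?thesis using hat Vh_ends[OF \<phi>] i by (auto simp: nodes_iff)
  qed
  have lumped_\<phi>: "lumped h sm sp f \<phi> = node_mass i * f (X i)" for f
    by (rule lumped_hat[OF i]) (rule hat)
  have u: "u \<in> Vh h sm sp" using step by (simp add: parabolic_step_def)
  have "L2_inner (deriv u) (deriv (\<lambda>x. w x * \<phi> x)) = (\<Sum>j\<in>cells h sm sp.
      (if j = i then \<sigma> u i * w (X i) else 0) - (if j = i + 1 then \<sigma> u (i + 1) * w (X i) else 0))"
    unfolding L2_inner_deriv[OF u w \<phi>] by (intro sum.cong) (auto simp: hat' cells_iff)
  also have "\<dots> = w (X i) * (\<sigma> u i - \<sigma> u (i + 1))"
    using i by (simp add: sum_subtractf cells_def nodes_iff algebra_simps)
  finally have L2: "L2_inner (deriv u) (deriv (\<lambda>x. w x * \<phi> x)) = w (X i) * (\<sigma> u i - \<sigma> u (i + 1))" .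
  have "lumped h sm sp u \<phi> + \<tau> * L2_inner (deriv u) (deriv (\<lambda>x. w x * \<phi> x)) =
      lumped h sm sp w \<phi>
      + m * q * \<tau> * lumped h sm sp (lagrange h sm sp (\<lambda>x. w x powr q * u x)) \<phi>
      + m * (1 - q) * \<tau> * lumped h sm sp (lagrange h sm sp (\<lambda>x. w x powr (q + 1))) \<phi>"
    using step \<phi> unfolding parabolic_step_def by blast
  then show ?thesis
    unfolding L2 lumped_\<phi> lagrange_spec(2)[OF i]
    by (simp only: distrib_left mult.left_commute[of "node_mass i"])
qed

text \<open>
  The node equation reads
  \<open>(1 - m q \<tau> w\<^sub>i\<^sup>q) (u\<^sub>i - growth w\<^sub>i) = \<tau> w\<^sub>i (\<sigma>\<^sub>i\<^sub>+\<^sub>1 - \<sigma>\<^sub>i) / mass\<^sub>i\<close>.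
\<close>

lemma parabolic_step_compare:
  assumes step: "parabolic_step m q \<tau> h sm sp w u" and w: "w \<in> Vh h sm sp"
    and i: "i \<in> nodes h sm sp" and "0 \<le> w (X i)" "0 < \<tau>" "m * q * \<tau> * w (X i) powr q < 1"
  shows "\<sigma> u (i + 1) \<le> \<sigma> u i \<Longrightarrow> u (X i) \<le> growth m q \<tau> (w (X i))"
    and "\<sigma> u i \<le> \<sigma> u (i + 1) \<Longrightarrow> growth m q \<tau> (w (X i)) \<le> u (X i)"
proof -
  define W where "W = w (X i)"
  define Y where "Y = W powr q"
  define d where "d = 1 - m * q * \<tau> * Y"
  define M where "M = node_mass i"
  note M = node_mass_pos[OF i, folded M_def]
  have d: "0 < d" using assms by (simp add: d_def Y_def W_def)
  have g: "d * growth m q \<tau> W = W + m * (1 - q) * \<tau> * (W * Y)"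
    using d unfolding growth_def Y_def[symmetric] d_def[symmetric]
    by (simp add: field_simps) (simp add: d_def algebra_simps)
  have "W powr (q + 1) = W * Y"
    using powr_mult_base[of W q] assms by (simp add: Y_def W_def add.commute)
  then have "M * u (X i) + \<tau> * (W * (\<sigma> u i - \<sigma> u (i + 1))) =
      M * (W + m * q * \<tau> * (Y * u (X i)) + m * (1 - q) * \<tau> * (W * Y))"
    using parabolic_step_node[OF step w i] by (simp add: W_def Y_def M_def)
  \<comment> \<open>Here the denominator of \<open>growth\<close> has been cleared, so the reaction
    terms are absorbed exactly and only the diffusion term is left on the right.\<close>
  then have eq: "M * d * (u (X i) - growth m q \<tau> W) = \<tau> * W * (\<sigma> u (i + 1) - \<sigma> u i)"
    using g unfolding d_def by algebra
  have Md: "0 < M * d" using M d by simp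
  have W: "0 \<le> \<tau> * W" using assms by (simp add: W_def)
  show "u (X i) \<le> growth m q \<tau> (w (X i))" if "\<sigma> u (i + 1) \<le> \<sigma> u i"
  proof -
    have "\<tau> * W * (\<sigma> u (i + 1) - \<sigma> u i) \<le> 0"
      using that by (intro mult_nonneg_nonpos[OF W]) auto
    with eq Md have "u (X i) - growth m q \<tau> W \<le> 0"
      by (metis mult_le_0_iff not_less)
    then show ?thesis by (simp add: W_def)
  qed
  show "growth m q \<tau> (w (X i)) \<le> u (X i)" if "\<sigma> u i \<le> \<sigma> u (i + 1)"
  proof -
    have "0 \<le> \<tau> * W * (\<sigma> u (i + 1) - \<sigma> u i)"
      using that by (intro mult_nonneg_nonneg[OF W]) auto
    with eq Md have "0 \<le> u (X i) - growth m q \<tau> W"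
      by (metis zero_le_mult_iff not_less)
    then show ?thesis by (simp add: W_def)
  qed
qed

text \<open>A discrete maximum principle, used once for the nodal values and once for the slopes.
  The hypotheses on \<open>Y\<close> and \<open>\<delta>\<close> keep
  \<open>1 - m q \<tau> w^q\<close> at least \<open>\<delta>\<close> everywhere, as the nodal
  comparison and the Lipschitz bound of \<open>growth\<close> require.\<close>

lemma parabolic_step_bounds:
  assumes mq: "0 < m" "0 < q" "q < 1" "0 < \<tau>"
    and step: "parabolic_step m q \<tau> h sm sp w u" and w: "w \<in> Vh h sm sp"
    and wM: "\<And>x. 0 \<le> w x \<and> w x \<le> M"
    and Y: "M powr q \<le> Y" and \<delta>: "0 < \<delta>" "\<delta> \<le> 1 - m * q * \<tau> * Y"
  shows "0 \<le> u x \<and> u x \<le> growth m q \<tau> M"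
    and "(\<And>i. i \<in> cells h sm sp \<Longrightarrow> \<bar>\<sigma> w i\<bar> \<le> V) \<Longrightarrow> i \<in> cells h sm sp \<Longrightarrow>
      \<bar>\<sigma> u i\<bar> \<le> (1 + 2 * m * Y / \<delta>\<^sup>2 * \<tau>) * V"
proof -
  have u: "u \<in> Vh h sm sp" using step by (simp add: parabolic_step_def)
  have wY: "w x powr q \<le> Y" for x
    using powr_mono2[of q "w x" M] wM[of x] mq Y by simp
  have small: "m * q * \<tau> * w x powr q < 1" for x
  proof -
    have "m * q * \<tau> * w x powr q \<le> m * q * \<tau> * Y"
      using wY mq by (intro mult_left_mono) auto
    then show ?thesis using \<delta> by linarith
  qed
  have M0: "0 \<le> M" using wM[of 0] by linarith
  note cmp = parabolic_step_compare[OF step w _ conjunct1[OF wM] mq(4) small]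
  note gm = growth_mono_lipschitz[OF mq _ _ _ \<delta>]
  have g0: "0 \<le> growth m q \<tau> (w x)" "growth m q \<tau> (w x) \<le> growth m q \<tau> M" "0 \<le> growth m q \<tau> M" for x
    using gm(1)[of 0 "w x"] gm(1)[of "w x" M] gm(1)[of 0 M] wM[of x] wY[of x] Y M0 by auto
  have glip: "\<bar>growth m q \<tau> (w y) - growth m q \<tau> (w x)\<bar> \<le> (1 + 2 * m * Y / \<delta>\<^sup>2 * \<tau>) * \<bar>w y - w x\<bar>" for x y
    using gm[of "w x" "w y"] gm[of "w y" "w x"] wM[of x] wM[of y] wY[of x] wY[of y]
    by (cases "w x \<le> w y") (auto simp: abs_if)
  \<comment> \<open>All vertices, end points included. At the end points \<open>u\<close>,
    \<open>w\<close> and \<open>growth\<close> of \<open>w\<close> are 0, so the nodal comparison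
    holds there in both directions and an extremal cell may be an end cell.\<close>
  let ?I = "{a - 1..b + 1}"
  have I: "finite ?I" "?I \<noteq> {}" using first_last by auto
  have I_cases: "i \<in> nodes h sm sp \<or> (u (X i) = 0 \<and> w (X i) = 0)" if "i \<in> ?I" for i
  proof -
    have "i \<in> nodes h sm sp \<or> i = a - 1 \<or> i = b + 1" using that by (auto simp: nodes_iff)
    then show ?thesis using Vh_ends[OF u] Vh_ends[OF w] by auto
  qed
  have node_cells: "i \<in> cells h sm sp" "i + 1 \<in> cells h sm sp" if "i \<in> nodes h sm sp" for i
    using that by (auto simp: cells_iff nodes_iff)
  have slope_sign: "0 \<le> \<sigma> u j \<longleftrightarrow> u (X (j - 1)) \<le> u (X j)" "\<sigma> u j \<le> 0 \<longleftrightarrow> u (X j) \<le> u (X (j - 1))"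
    if "j \<in> cells h sm sp" for j
    using slope_eq[OF u that] X_less[OF that]
    by (simp_all add: zero_le_divide_iff divide_le_0_iff)
  have lower: "0 \<le> u (X j)" if "j \<in> ?I" for j
  proof -
    obtain i where i: "i \<in> ?I" "\<And>j. j \<in> ?I \<Longrightarrow> u (X i) \<le> u (X j)"
      using finite_argmin[OF I, of "\<lambda>j. u (X j)"] by blast
    have "0 \<le> u (X i)"
    proof (cases "i \<in> nodes h sm sp")
      case True
      \<comment> \<open>At a minimal node the slope turns from nonpositive to nonnegative, which is
        the case of the comparison giving a lower bound.\<close>
      then have "\<sigma> u i \<le> 0" "0 \<le> \<sigma> u (i + 1)"
        using i node_cells[OF True] by (auto simp: slope_sign nodes_iff)
      then have "growth m q \<tau> (w (X i)) \<le> u (X i)" by (intro cmp(2)[OF True]) simp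
      then show ?thesis using g0(1)[of "X i"] by simp
    next
      case False
      then have "u (X i) = 0" using I_cases[OF i(1)] by blast
      then show ?thesis by simp
    qed
    with i(2)[OF that] show ?thesis by simp
  qed
  have upper: "u (X j) \<le> growth m q \<tau> M" if "j \<in> ?I" for j
  proof -
    obtain i where i: "i \<in> ?I" "\<And>j. j \<in> ?I \<Longrightarrow> u (X j) \<le> u (X i)"
      using finite_argmax[OF I, of "\<lambda>j. u (X j)"] by blast
    have "u (X i) \<le> growth m q \<tau> M"
    proof (cases "i \<in> nodes h sm sp")
      case True
      then have "0 \<le> \<sigma> u i" "\<sigma> u (i + 1) \<le> 0"
        using i node_cells[OF True] by (auto simp: slope_sign nodes_iff)
      then have "u (X i) \<le> growth m q \<tau> (w (X i))" by (intro cmp(1)[OF True]) simp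
      then show ?thesis using g0(2)[of "X i"] by simp
    next
      case False
      then have "u (X i) = 0" using I_cases[OF i(1)] by blast
      then show ?thesis by (simp add: g0)
    qed
    with i(2)[OF that] show ?thesis by simp
  qed
  show "0 \<le> u x \<and> u x \<le> growth m q \<tau> M"
  proof (rule Vh_nonneg_le[OF u g0(3)])
    show "0 \<le> u (X i) \<and> u (X i) \<le> growth m q \<tau> M" if "i \<in> nodes h sm sp" for i
      by (intro conjI lower upper) (use that in \<open>auto simp: nodes_iff\<close>)
  qed
  have node_le: "u (X j) \<le> growth m q \<tau> (w (X j))"
    if "j \<in> ?I" "j \<in> nodes h sm sp \<Longrightarrow> \<sigma> u (j + 1) \<le> \<sigma> u j" for j
  proof (cases "j \<in> nodes h sm sp")
    case True
    then show ?thesis by (intro cmp(1) that(2))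
  next
    case False
    then have "u (X j) = 0" "w (X j) = 0" using I_cases[OF that(1)] by blast+
    then show ?thesis by simp
  qed
  have node_ge: "growth m q \<tau> (w (X j)) \<le> u (X j)"
    if "j \<in> ?I" "j \<in> nodes h sm sp \<Longrightarrow> \<sigma> u j \<le> \<sigma> u (j + 1)" for j
  proof (cases "j \<in> nodes h sm sp")
    case True
    then show ?thesis by (intro cmp(2) that(2))
  next
    case False
    then have "u (X j) = 0" "w (X j) = 0" using I_cases[OF that(1)] by blast+
    then show ?thesis by simp
  qed
  let ?L = "1 + 2 * m * Y / \<delta>\<^sup>2 * \<tau>"
  have "0 \<le> Y" using Y powr_ge_zero[of M q] by linarith
  then have L0: "0 \<le> ?L" using mq by simp
  assume V: "\<And>i. i \<in> cells h sm sp \<Longrightarrow> \<bar>\<sigma> w i\<bar> \<le> V"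
  have key: "\<bar>growth m q \<tau> (w (X j)) - growth m q \<tau> (w (X (j - 1)))\<bar> \<le> ?L * V * (X j - X (j - 1))"
    if j: "j \<in> cells h sm sp" for j
  proof -
    have "\<bar>w (X j) - w (X (j - 1))\<bar> = \<bar>\<sigma> w j\<bar> * (X j - X (j - 1))"
      using X_less[OF j] by (simp add: slope_mult[OF w j, symmetric] abs_mult)
    also have "\<dots> \<le> V * (X j - X (j - 1))"
      using V[OF j] X_less[OF j] by (intro mult_right_mono) auto
    finally have "?L * \<bar>w (X j) - w (X (j - 1))\<bar> \<le> ?L * (V * (X j - X (j - 1)))"
      using L0 by (intro mult_left_mono)
    then show ?thesis using glip[of "X j" "X (j - 1)"] by (simp only: mult.assoc)
  qed
  have C: "finite (cells h sm sp)" "cells h sm sp \<noteq> {}" using first_last by (auto simp: cells_def)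
  assume ic: "i \<in> cells h sm sp"
  have "\<sigma> u i \<le> ?L * V"
  proof -
    obtain j where j: "j \<in> cells h sm sp" "\<And>k. k \<in> cells h sm sp \<Longrightarrow> \<sigma> u k \<le> \<sigma> u j"
      using finite_argmax[OF C, of "\<sigma> u"] by blast
    have "j \<in> ?I" "j - 1 \<in> ?I" using j(1) by (auto simp: cells_iff)
    \<comment> \<open>Neither neighbouring slope exceeds the maximal one, so the right value is
      bounded above and the left value below; their difference is bounded by an increment of
      \<open>growth\<close>.\<close>
    have "u (X j) \<le> growth m q \<tau> (w (X j))"
      by (rule node_le[OF \<open>j \<in> ?I\<close>]) (rule j(2), rule node_cells(2))
    moreover have "growth m q \<tau> (w (X (j - 1))) \<le> u (X (j - 1))"
      by (rule node_ge[OF \<open>j - 1 \<in> ?I\<close>]) (simp, rule j(2), rule node_cells(1))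
    ultimately have "\<sigma> u j * (X j - X (j - 1)) \<le> ?L * V * (X j - X (j - 1))"
      using key[OF j(1)] slope_mult[OF u j(1)] by linarith
    then have "\<sigma> u j \<le> ?L * V"
      by (rule mult_right_le_imp_le) (use X_less[OF j(1)] in simp)
    then show ?thesis using j(2)[OF ic] by linarith
  qed
  moreover have "- (?L * V) \<le> \<sigma> u i"
  proof -
    obtain j where j: "j \<in> cells h sm sp" "\<And>k. k \<in> cells h sm sp \<Longrightarrow> \<sigma> u j \<le> \<sigma> u k"
      using finite_argmin[OF C, of "\<sigma> u"] by blast
    have "j \<in> ?I" "j - 1 \<in> ?I" using j(1) by (auto simp: cells_iff)
    have "growth m q \<tau> (w (X j)) \<le> u (X j)"
      by (rule node_ge[OF \<open>j \<in> ?I\<close>]) (rule j(2), rule node_cells(2))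
    moreover have "u (X (j - 1)) \<le> growth m q \<tau> (w (X (j - 1)))"
      by (rule node_le[OF \<open>j - 1 \<in> ?I\<close>]) (simp, rule j(2), rule node_cells(1))
    ultimately have "- (?L * V) * (X j - X (j - 1)) \<le> \<sigma> u j * (X j - X (j - 1))"
      using key[OF j(1)] slope_mult[OF u j(1)] by (simp only: minus_mult_left[symmetric])
    then have "- (?L * V) \<le> \<sigma> u j"
      by (rule mult_right_le_imp_le) (use X_less[OF j(1)] in simp)
    then show ?thesis using j(2)[OF ic] by linarith
  qed
  ultimately show "\<bar>\<sigma> u i\<bar> \<le> ?L * V" by linarith
qed

end

section \<open>The hyperbolic step\<close>

lemma hopf_lax_le:
  assumes "\<And>y. u y \<le> c + m * (x - y)\<^sup>2 / (4 * \<tau>)"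
  shows "hopf_lax m \<tau> u x \<le> c"
  unfolding hopf_lax_def using assms by (intro cSUP_least) (auto simp: diff_le_eq)

text \<open>A real \<open>SUP\<close> dominates its terms only if they are bounded above, which
  \<open>M\<close> ensures.\<close>

lemma hopf_lax_ge:
  assumes "0 < m" "0 < \<tau>" "\<And>y. u y \<le> M"
  shows "u y - m * (x - y)\<^sup>2 / (4 * \<tau>) \<le> hopf_lax m \<tau> u x"
  unfolding hopf_lax_def
proof (rule cSUP_upper)
  have "u y - m * (x - y)\<^sup>2 / (4 * \<tau>) \<le> M" for y
  proof -
    have "0 \<le> m * (x - y)\<^sup>2 / (4 * \<tau>)" using assms by simp
    then show ?thesis using assms(3)[of y] by linarith
  qed
  then show "bdd_above (range (\<lambda>y. u y - m * (x - y)\<^sup>2 / (4 * \<tau>)))"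
    by (rule bdd_aboveI2)
qed simp

text \<open>The Hopf--Lax formula is a supremum of translates of \<open>u\<close>.\<close>

lemma hopf_lax_lipschitz:
  assumes "0 < m" "0 < \<tau>" "\<And>y. u y \<le> M" and lip: "\<And>x y. \<bar>u x - u y\<bar> \<le> V * \<bar>x - y\<bar>"
  shows "\<bar>hopf_lax m \<tau> u x - hopf_lax m \<tau> u y\<bar> \<le> V * \<bar>x - y\<bar>"
proof -
  have *: "hopf_lax m \<tau> u x \<le> hopf_lax m \<tau> u y + V * \<bar>x - y\<bar>" for x y
  proof (rule hopf_lax_le)
    fix z
    \<comment> \<open>The competitor \<open>z + y - x\<close> has the same offset from
      \<open>y\<close> as \<open>z\<close> has from \<open>x\<close>, so the two parabola terms
      coincide.\<close>
    have "u z \<le> u (z + y - x) + V * \<bar>x - y\<bar>"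
      using lip[of z "z + y - x"] by (simp add: abs_le_iff)
    moreover have "u (z + y - x) - m * (y - (z + y - x))\<^sup>2 / (4 * \<tau>) \<le> hopf_lax m \<tau> u y"
      by (rule hopf_lax_ge[OF assms(1-3)])
    ultimately show "u z \<le> hopf_lax m \<tau> u y + V * \<bar>x - y\<bar> + m * (x - z)\<^sup>2 / (4 * \<tau>)"
      by simp
  qed
  show ?thesis
    using *[of x y] *[of y x] by (simp add: abs_le_iff abs_minus_commute)
qed

text \<open>The difference of the two sides is a perfect square. Here \<open>d\<close> is the
  distance from the old end point into the support, \<open>p\<close> the steepness of the end cell,
  and \<open>\<tau> / m * p\<close> the displacement of the end point.\<close>

lemma parabola_above_line:
  fixes m \<tau> p d :: real
  assumes "0 < m" "0 < \<tau>"
  shows "p * d \<le> m * (d + \<tau> / m * p)\<^sup>2 / (4 * \<tau>)"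
proof -
  have "m * (d + \<tau> / m * p)\<^sup>2 / (4 * \<tau>) - p * d = m * (d - \<tau> / m * p)\<^sup>2 / (4 * \<tau>)"
    using assms by (simp add: power2_eq_square field_simps)
  moreover have "0 \<le> m * (d - \<tau> / m * p)\<^sup>2 / (4 * \<tau>)" using assms by simp
  ultimately show ?thesis by linarith
qed

text \<open>Beyond the end cell, of length \<open>H\<close>, the parabola has chord slope at least
  \<open>m (d + H) / (4 \<tau>)\<close>. As \<open>d + H \<ge> 2 h\<close>, this is at least
  \<open>m h / (2 \<tau>)\<close>, hence at least \<open>V\<close>: the constant
  \<open>m / 2\<close> of the stability condition enters here.\<close>

lemma parabola_above_broken_line:
  fixes m \<tau> p d h H V :: real
  assumes "0 < m" "0 < \<tau>" "0 \<le> p" "V * \<tau> \<le> m * h / 2" "h \<le> H" "H \<le> d"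
  shows "p * H + V * (d - H) \<le> m * (d + \<tau> / m * p)\<^sup>2 / (4 * \<tau>)"
proof -
  have "V \<le> m * h / (2 * \<tau>)" using assms by (simp add: field_simps)
  also have "\<dots> = m * (2 * h) / (4 * \<tau>)" by simp
  also have "\<dots> \<le> m * (d + H) / (4 * \<tau>)"
    using assms by (intro divide_right_mono mult_left_mono) auto
  finally have "V * (d - H) \<le> m * (d + H) / (4 * \<tau>) * (d - H)"
    using assms by (intro mult_right_mono) auto
  moreover have "0 \<le> p * (d - H) / 2" using assms by simp
  moreover have "m * (d + \<tau> / m * p)\<^sup>2 / (4 * \<tau>) - m * (H + \<tau> / m * p)\<^sup>2 / (4 * \<tau>) =
      m * (d + H) / (4 * \<tau>) * (d - H) + p * (d - H) / 2"
    using assms by (simp add: power2_eq_square field_simps)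
  ultimately show ?thesis
    using parabola_above_line[OF assms(1,2), of p H] by linarith
qed

context mesh
begin

text \<open>
  By the stability condition, only the end cell can influence the new end point, and there the
  parabola in the Hopf--Lax formula touches the graph of \<open>u\<close> from above.
\<close>

lemma hopf_lax_ends:
  assumes m: "0 < m" "0 < \<tau>" and u: "u \<in> Vh h sm sp" and u0: "\<And>x. 0 \<le> u x"
    and V: "0 \<le> V" "\<And>i. i \<in> cells h sm sp \<Longrightarrow> \<bar>\<sigma> u i\<bar> \<le> V"
    and stab: "V * \<tau> \<le> m * h / 2"
  shows "hopf_lax m \<tau> u (sp - \<tau> / m * \<sigma> u (b + 1)) \<le> 0" "\<sigma> u (b + 1) \<le> 0"
    and "hopf_lax m \<tau> u (- (sm + \<tau> / m * \<sigma> u a)) \<le> 0" "0 \<le> \<sigma> u a"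
proof -
  have ab: "a \<in> cells h sm sp" "b + 1 \<in> cells h sm sp" using first_last by (auto simp: cells_iff)
  note lip = Vh_lipschitz[OF u V]
  have sq: "0 \<le> m * z\<^sup>2 / (4 * \<tau>)" for z using m by simp
  show s: "\<sigma> u (b + 1) \<le> 0" "0 \<le> \<sigma> u a"
    using slope_eq[OF u ab(2)] slope_eq[OF u ab(1)] Vh_ends[OF u] X_less[OF ab(1)] X_less[OF ab(2)]
      u0[of "X a"] u0[of "X b"]
    by (auto simp: divide_le_0_iff zero_le_divide_iff)
  show "hopf_lax m \<tau> u (sp - \<tau> / m * \<sigma> u (b + 1)) \<le> 0"
  proof (rule hopf_lax_le)
    fix y
    \<comment> \<open>In the end cell \<open>u\<close> equals \<open>?p * ?d\<close>, and the new
      end point lies \<open>\<tau> / m * ?p\<close> beyond \<open>sp\<close>. Outside the support,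
      in the end cell and further inside, the bound comes from 0, the line and the broken line
      respectively.\<close>
    let ?p = "- \<sigma> u (b + 1)" and ?d = "sp - y" and ?H = "sp - X b"
    have ub: "u (X b) = ?p * ?H"
      using slope_mult[OF u ab(2)] Vh_ends[OF u] X_last by simp
    have "u y \<le> m * (?d + \<tau> / m * ?p)\<^sup>2 / (4 * \<tau>)"
    proof -
      consider "sp \<le> y" | "X b \<le> y" "y \<le> sp" | "y \<le> X b" by linarith
      then show ?thesis
      proof cases
        case 1
        then have "u y = 0" using Vh_outside[OF u, of y] by simp
        then show ?thesis using sq by simp
      next
        case 2
        have "u y = u (X b) + \<sigma> u (b + 1) * (y - X b)"
          using Vh_cell_affine[OF u ab(2), of y] 2 X_last by simp
        then have "u y = ?p * ?d" using ub by (simp add: algebra_simps)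
        then show ?thesis using parabola_above_line[OF m, of ?p ?d] by simp
      next
        case 3
        have "u y \<le> u (X b) + V * (X b - y)"
          using lip[of y "X b"] 3 by (simp add: abs_le_iff)
        also have "\<dots> = ?p * ?H + V * (?d - ?H)" using ub by simp
        also have "\<dots> \<le> m * (?d + \<tau> / m * ?p)\<^sup>2 / (4 * \<tau>)"
          using 3 s cell_length_ge[OF ab(2)] X_last
          by (intro parabola_above_broken_line[OF m _ stab]) auto
        finally show ?thesis .
      qed
    qed
    then show "u y \<le> 0 + m * (sp - \<tau> / m * \<sigma> u (b + 1) - y)\<^sup>2 / (4 * \<tau>)"
      by (simp add: algebra_simps)
  qed
  show "hopf_lax m \<tau> u (- (sm + \<tau> / m * \<sigma> u a)) \<le> 0"
  proof (rule hopf_lax_le)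
    fix y
    let ?p = "\<sigma> u a" and ?d = "sm + y" and ?H = "sm + X a"
    have ua: "u (X a) = ?p * ?H"
      using slope_mult[OF u ab(1)] Vh_ends[OF u] X_first by (simp add: algebra_simps)
    have "u y \<le> m * (?d + \<tau> / m * ?p)\<^sup>2 / (4 * \<tau>)"
    proof -
      consider "y \<le> - sm" | "- sm \<le> y" "y \<le> X a" | "X a \<le> y" by linarith
      then show ?thesis
      proof cases
        case 1
        then have "u y = 0" using Vh_outside[OF u, of y] by simp
        then show ?thesis using sq by simp
      next
        case 2
        have "u y = \<sigma> u a * (y + sm)"
          using Vh_cell_affine[OF u ab(1), of y] 2 X_first Vh_ends[OF u] by simp
        then have "u y = ?p * ?d" by (simp add: algebra_simps)
        then show ?thesis using parabola_above_line[OF m, of ?p ?d] by simp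
      next
        case 3
        have "u y \<le> u (X a) + V * (y - X a)"
          using lip[of y "X a"] 3 by (simp add: abs_le_iff)
        also have "\<dots> = ?p * ?H + V * (?d - ?H)" using ua by simp
        also have "\<dots> \<le> m * (?d + \<tau> / m * ?p)\<^sup>2 / (4 * \<tau>)"
          using 3 s cell_length_ge[OF ab(1)] X_first
          by (intro parabola_above_broken_line[OF m _ stab]) auto
        finally show ?thesis .
      qed
    qed
    moreover have "(- (sm + \<tau> / m * \<sigma> u a) - y)\<^sup>2 = (?d + \<tau> / m * ?p)\<^sup>2"
      by (simp add: power2_eq_square algebra_simps)
    ultimately show "u y \<le> 0 + m * (- (sm + \<tau> / m * \<sigma> u a) - y)\<^sup>2 / (4 * \<tau>)"
      by simp
  qed
qed

text \<open>The Hopf-Lax solution inherits the range and the Lipschitz constant of \<open>u\<close>.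
  Interpolation preserves both, because the difference quotients of \<open>w\<close> are those of
  the Hopf-Lax solution, in the end cells too.\<close>

lemma hyperbolic_step_bounds:
  assumes m: "0 < m" "0 < \<tau>" and u: "u \<in> Vh h sm sp" and uM: "\<And>x. 0 \<le> u x \<and> u x \<le> M"
    and V: "0 \<le> V" "\<And>i. i \<in> cells h sm sp \<Longrightarrow> \<bar>\<sigma> u i\<bar> \<le> V"
    and stab: "V * \<tau> \<le> m * h / 2"
    and sp': "sp' = sp - \<tau> / m * \<sigma> u (Nend h sp)"
    and sm': "sm' = sm + \<tau> / m * \<sigma> u (- Nend h sm + 1)"
    and w: "w = lagrange h sm' sp' (hopf_lax m \<tau> u)"
  shows "mesh h sm' sp'" "w \<in> Vh h sm' sp'" "0 \<le> w x \<and> w x \<le> M"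
    "i \<in> cells h sm' sp' \<Longrightarrow> \<bar>slope h sm' sp' w i\<bar> \<le> V"
proof -
  have u0: "0 \<le> u y" and u_le: "u y \<le> M" for y using uM by auto
  note ends = hopf_lax_ends[OF m u u0 V stab]
  have sp_eq: "sp' = sp - \<tau> / m * \<sigma> u (b + 1)" and sm_eq: "sm' = sm + \<tau> / m * \<sigma> u a"
    by (simp_all add: sp' sm' last_node_def first_node_def)
  have "0 \<le> \<tau> / m * \<sigma> u a" "\<tau> / m * \<sigma> u (b + 1) \<le> 0"
    using ends m by (auto simp del: times_divide_eq_left intro!: mult_nonneg_nonneg mult_nonneg_nonpos)
  then show mesh': "mesh h sm' sp'"
    using mesh_bounds sp_eq sm_eq by unfold_locales auto
  interpret N: mesh h sm' sp' by (rule mesh')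
  define H where "H = hopf_lax m \<tau> u"
  have H_lip: "\<bar>H x - H y\<bar> \<le> V * \<bar>x - y\<bar>" for x y
    unfolding H_def by (rule hopf_lax_lipschitz[OF m u_le Vh_lipschitz[OF u V]])
  have H0: "0 \<le> H y" for y
    using hopf_lax_ge[of m \<tau> u M y y] m u_le u0[of y] by (simp add: H_def)
  have HM: "H y \<le> M" for y
    unfolding H_def
  proof (rule hopf_lax_le)
    fix z
    have "0 \<le> m * (y - z)\<^sup>2 / (4 * \<tau>)" using m by simp
    then show "u z \<le> M + m * (y - z)\<^sup>2 / (4 * \<tau>)" using u_le[of z] by linarith
  qed
  show wV: "w \<in> Vh h sm' sp'" by (simp add: w N.lagrange_spec)
  \<comment> \<open>Interpolation is exact also at the end points: \<open>w\<close> is 0 there by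
    definition of the space, the Hopf-Lax solution by \<open>hopf_lax_ends\<close>.\<close>
  have wH: "w (N.X j) = H (N.X j)" if "j \<in> {N.a - 1..N.b + 1}" for j
  proof -
    have "N.a - 1 \<le> j" "j \<le> N.b + 1" using that by simp_all
    then consider "j \<in> nodes h sm' sp'" | "j = N.a - 1" | "j = N.b + 1"
      unfolding N.nodes_iff by linarith
    then show ?thesis
    proof cases
      case 1
      then show ?thesis by (simp add: w H_def N.lagrange_spec)
    next
      case 2
      have "H (- sm') = 0"
        using ends(3) H0[of "- sm'"] unfolding H_def sm_eq by linarith
      then show ?thesis using 2 N.Vh_ends[OF wV] N.X_first by simp
    next
      case 3
      have "H sp' = 0"
        using ends(1) H0[of sp'] unfolding H_def sp_eq by linarith
      then show ?thesis using 3 N.Vh_ends[OF wV] N.X_last by simp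
    qed
  qed
  show "0 \<le> w x \<and> w x \<le> M"
  proof (rule N.Vh_nonneg_le[OF wV])
    show "0 \<le> M" using u0[of 0] u_le[of 0] by linarith
    show "0 \<le> w (N.X j) \<and> w (N.X j) \<le> M" if "j \<in> nodes h sm' sp'" for j
      using wH[of j] that H0 HM by (simp add: N.nodes_iff)
  qed
  show "\<bar>slope h sm' sp' w i\<bar> \<le> V" if i: "i \<in> cells h sm' sp'"
  proof -
    have "slope h sm' sp' w i = (H (N.X i) - H (N.X (i - 1))) / (N.X i - N.X (i - 1))"
      using N.slope_eq[OF wV i] wH[of i] wH[of "i - 1"] i by (simp add: N.cells_iff)
    then show ?thesis
      using H_lip[of "N.X i" "N.X (i - 1)"] N.X_less[OF i] by (simp add: abs_divide pos_divide_le_eq)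
  qed
qed

end

section \<open>Propagation of the bounds\<close>

text \<open>By continuity the set where the norm is exceeded is open; being a null set, it is
  empty.\<close>

lemma abs_le_Linf_norm:
  assumes f: "continuous_on UNIV f"
  shows "ereal \<bar>f x\<bar> \<le> Linf_norm f"
proof (rule ccontr)
  let ?A = "{y. Linf_norm f < ereal \<bar>f y\<bar>}"
  assume "\<not> ereal \<bar>f x\<bar> \<le> Linf_norm f"
  then have "x \<in> ?A" by (simp add: not_le)
  then have ne: "?A \<noteq> {}" by blast
  have "continuous_on UNIV (\<lambda>y. ereal \<bar>f y\<bar>)"
    by (intro continuous_intros f)
  then have op: "open ?A"
    by (intro open_Collect_less continuous_on_const)
  have "AE y in lborel. y \<notin> ?A"
    using esssup_AE[of "\<lambda>y. ereal \<bar>f y\<bar>" lborel]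
    by eventually_elim (simp add: Linf_norm_def)
  then have "?A \<in> null_sets lborel"
    using op by (subst AE_iff_null_sets) auto
  then have "negligible ?A"
    by (simp add: negligible_iff_null_sets null_sets_completionI)
  with open_not_negligible[OF op ne] show False by simp
qed

text \<open>Replaces \<open>T1\<close> by a real bound \<open>M\<close>, the form that the induction
  propagates. \<open>B\<close> shows that the norm is finite; the zero function, with
  \<open>T1\<close> infinite, takes \<open>M = 0\<close>.\<close>

lemma T1_bound:
  assumes "0 < m" "0 < q" "0 < S" and f: "continuous_on UNIV f" "\<And>x. 0 \<le> f x \<and> f x \<le> B"
    and S: "ereal S \<le> T1 m q f"
  obtains M where "\<And>x. 0 \<le> f x \<and> f x \<le> M" "m * q * M powr q * S \<le> 1"
proof (cases "\<forall>x. f x = 0")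
  case True
  then show ?thesis by (intro that[of 0]) auto
next
  case False
  then obtain x0 where x0: "f x0 \<noteq> 0" by auto
  have "Linf_norm f \<le> ereal B"
    unfolding Linf_norm_def
  proof (rule esssup_I)
    have "f \<in> borel_measurable borel"
      by (rule borel_measurable_continuous_onI[OF f(1)])
    then show "(\<lambda>x. ereal \<bar>f x\<bar>) \<in> borel_measurable lborel" by simp
    show "AE x in lborel. ereal \<bar>f x\<bar> \<le> ereal B" using f(2) by simp
  qed
  moreover note le = abs_le_Linf_norm[OF f(1)]
  ultimately obtain r where r: "Linf_norm f = ereal r"
    using le[of 0] by (cases "Linf_norm f") auto
  have fr: "\<bar>f x\<bar> \<le> r" for x using le[of x] r by simp
  have r0: "0 < r" using fr[of x0] x0 by linarith
  have "S \<le> 1 / (m * q * r powr q)"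
    using S False r by (simp add: T1_def)
  then have "m * q * r powr q * S \<le> 1"
    using assms(1,2) r0 by (simp add: pos_le_divide_eq mult.commute)
  then show ?thesis
    using fr f(2) by (intro that[of r]) (auto simp: abs_le_iff)
qed

text \<open>For \<open>M > 0\<close> the condition on \<open>M\<close> says that the solution of
  \<open>y' = m y^(q+1)\<close> with value \<open>M\<close> at time \<open>t\<close> does not blow
  up before \<open>S\<close>.\<close>

definition solution_bounds ::
  "real \<Rightarrow> real \<Rightarrow> real \<Rightarrow> real \<Rightarrow> real \<Rightarrow> real \<Rightarrow> real \<Rightarrow> (real \<Rightarrow> real) \<Rightarrow> real \<Rightarrow> bool" where
  "solution_bounds m q S h t sm sp f V \<longleftrightarrow> mesh h sm sp \<and> f \<in> Vh h sm sp \<and>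
     (\<exists>M. (\<forall>x. 0 \<le> f x \<and> f x \<le> M) \<and> m * q * M powr q * (S - t) \<le> 1) \<and>
     (\<forall>i\<in>cells h sm sp. \<bar>slope h sm sp f i\<bar> \<le> V)"

lemma solution_bounds_step:
  assumes mq: "0 < m" "0 < q" "q < 1" "0 < \<tau>" and t: "0 \<le> t" "t + \<tau> \<le> T" "T < S"
    and bd: "solution_bounds m q S h t sm sp u V"
    and stab: "ereal (\<tau> / h) * Linf_norm (vh h sm sp u) \<le> ereal (m / 2)"
    and sp': "sp' = sp - \<tau> / m * slope h sm sp u (Nend h sp)"
    and sm': "sm' = sm + \<tau> / m * slope h sm sp u (- Nend h sm + 1)"
    and step: "parabolic_step m q \<tau> h sm' sp' (lagrange h sm' sp' (hopf_lax m \<tau> u)) u'"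
  shows "solution_bounds m q S h (t + \<tau>) sm' sp' u' ((1 + 2 * S\<^sup>2 / (q * (S - T) ^ 3) * \<tau>) * V)"
proof -
  from bd interpret mesh h sm sp by (simp add: solution_bounds_def)
  from bd obtain M where u: "u \<in> Vh h sm sp" and uM: "\<And>x. 0 \<le> u x \<and> u x \<le> M"
    and MS: "m * q * M powr q * (S - t) \<le> 1" and V: "\<And>i. i \<in> cells h sm sp \<Longrightarrow> \<bar>\<sigma> u i\<bar> \<le> V"
    by (auto simp: solution_bounds_def)
  define w where "w = lagrange h sm' sp' (hopf_lax m \<tau> u)"
  \<comment> \<open>The stability condition limits the actual slopes, not their bound
    \<open>V\<close>. The minimum bounds the slopes and satisfies the condition; the estimate
    returns to \<open>V\<close> at the end.\<close>
  define V1 where "V1 = min V (m * h / (2 * \<tau>))"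
  have "Linf_norm (vh h sm sp u) \<le> ereal (m * h / (2 * \<tau>))"
    using stab h_pos mq by (cases "Linf_norm (vh h sm sp u)") (auto simp: field_simps)
  then have V1: "\<bar>\<sigma> u i\<bar> \<le> V1" if "i \<in> cells h sm sp" for i
    using V that by (simp add: Linf_norm_vh_le_iff V1_def)
  have "a \<in> cells h sm sp" using first_last by (simp add: cells_iff)
  then have V1_0: "0 \<le> V1" "0 \<le> V" using V1[of a] V[of a] by linarith+
  have "V1 * \<tau> \<le> m * h / (2 * \<tau>) * \<tau>"
    using mq by (intro mult_right_mono) (auto simp: V1_def)
  then have stab': "V1 * \<tau> \<le> m * h / 2" using mq by simp
  note hyp = hyperbolic_step_bounds[OF mq(1,4) u uM V1_0(1) V1 stab' sp' sm' w_def]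
  interpret N: mesh h sm' sp' by (rule hyp(1))
  \<comment> \<open>\<open>Y\<close> is the bound on \<open>M powr q\<close> given by the invariant,
    so \<open>1 - m q \<tau> Y = 1 - \<tau> / (S - t)\<close>; \<open>\<delta>\<close> bounds this
    from below uniformly in the time step.\<close>
  define Y where "Y = 1 / (m * q * (S - t))"
  define \<delta> where "\<delta> = (S - T) / S"
  have St: "0 < S - t" "0 < S" "0 < S - T" using t mq by linarith+
  have "M powr q \<le> Y"
    using MS St mq by (simp add: Y_def pos_le_divide_eq mult_ac)
  moreover have d0: "0 < \<delta>" using St by (simp add: \<delta>_def)
  moreover have "\<delta> \<le> (S - t - \<tau>) / (S - t)"
    unfolding \<delta>_def using St t mq by (intro frac_le) auto
  then have "\<delta> \<le> 1 - m * q * \<tau> * Y"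
    using mq St by (simp add: Y_def diff_divide_distrib)
  ultimately have Y: "M powr q \<le> Y" "0 < \<delta>" "\<delta> \<le> 1 - m * q * \<tau> * Y" by auto
  have "0 \<le> Y" using Y(1) powr_ge_zero[of M q] by linarith
  note par = N.parabolic_step_bounds[OF mq step[folded w_def] hyp(2,3) Y]
  let ?M = "growth m q \<tau> M"
  \<comment> \<open>In these terms \<open>growth_powr_le\<close> reads
    \<open>y' (1 - \<tau> y) \<le> y\<close>: the reciprocal of \<open>y\<close> drops by at most
    \<open>\<tau>\<close> per step, exactly as \<open>S - t\<close> does.\<close>
  define y where "y = m * q * M powr q"
  define y' where "y' = m * q * ?M powr q"
  have "m * q * \<tau> * M powr q \<le> m * q * \<tau> * Y" using Y mq by (intro mult_left_mono) auto
  then have small: "m * q * \<tau> * M powr q < 1" using Y by linarith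
  have "0 \<le> M" using uM[of 0] by linarith
  from growth_powr_le[OF mq this small]
  have "m * q * (?M powr q * (1 - m * q * \<tau> * M powr q)) \<le> m * q * M powr q"
    using mq by (intro mult_left_mono) auto
  then have "y' * (1 - \<tau> * y) \<le> y" by (simp add: y_def y'_def mult_ac)
  then have "y' * (1 - \<tau> * y) * (S - t - \<tau>) \<le> y * (S - t - \<tau>)"
    using t by (intro mult_right_mono) auto
  also have "\<dots> \<le> 1 - \<tau> * y" using MS by (simp add: y_def algebra_simps)
  finally have "y' * (S - t - \<tau>) * (1 - \<tau> * y) \<le> 1 * (1 - \<tau> * y)" by (simp add: mult_ac)
  then have "y' * (S - t - \<tau>) \<le> 1"
    by (rule mult_right_le_imp_le) (use small in \<open>simp add: y_def mult_ac\<close>)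
  then have 1: "m * q * ?M powr q * (S - (t + \<tau>)) \<le> 1" by (simp add: y'_def diff_diff_eq)
  have "Y \<le> 1 / (m * q * (S - T))"
    unfolding Y_def using mq t St by (intro divide_left_mono mult_left_mono) auto
  then have "2 * m * Y / \<delta>\<^sup>2 \<le> 2 * m * (1 / (m * q * (S - T))) / \<delta>\<^sup>2"
    using mq by (intro divide_right_mono mult_left_mono) auto
  also have "\<dots> = 2 * S\<^sup>2 / (q * (S - T) ^ 3)"
  proof -
    have "2 * m * (1 / (m * q * R)) / (R / S)\<^sup>2 = 2 * S\<^sup>2 / (q * R ^ 3)" if "0 < R" for R
      using mq St(2) that by (simp add: power2_eq_square power3_eq_cube field_simps)
    then show ?thesis unfolding \<delta>_def using St(3) by blast
  qed
  finally have C: "2 * m * Y / \<delta>\<^sup>2 \<le> 2 * S\<^sup>2 / (q * (S - T) ^ 3)" .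
  have "\<bar>N.\<sigma> u' i\<bar> \<le> (1 + 2 * S\<^sup>2 / (q * (S - T) ^ 3) * \<tau>) * V" if i: "i \<in> cells h sm' sp'" for i
  proof -
    have "\<bar>N.\<sigma> u' i\<bar> \<le> (1 + 2 * m * Y / \<delta>\<^sup>2 * \<tau>) * V1"
      using hyp(4) by (intro par(2) i)
    also have "\<dots> \<le> (1 + 2 * m * Y / \<delta>\<^sup>2 * \<tau>) * V"
      using mq \<open>0 \<le> Y\<close> by (intro mult_left_mono add_nonneg_nonneg) (auto simp: V1_def)
    also have "\<dots> \<le> (1 + 2 * S\<^sup>2 / (q * (S - T) ^ 3) * \<tau>) * V"
      using mq C V1_0 by (intro mult_right_mono add_left_mono) auto
    finally show ?thesis .
  qed
  moreover have "u' \<in> Vh h sm' sp'" using step by (simp add: parabolic_step_def)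
  ultimately show ?thesis
    unfolding solution_bounds_def using hyp(1) par(1) 1 by blast
qed

text \<open>\<open>T1\<close> and the initial slopes depend on \<open>h\<close> through
  \<open>u 0\<close>. \<open>S\<close> and \<open>K\<close> control them independently of the mesh,
  so that \<open>C\<close> can be chosen before the mesh, the time steps and
  \<open>n\<close>.\<close>

theorem lemma2p5:
  fixes m q s0 :: real and u0 :: "real \<Rightarrow> real" and T S K :: real
  assumes "m > 0" and "0 < q" and "q < 1" and "s0 > 0"
    and "continuous_on UNIV u0" and "\<And>x. u0 x \<ge> 0" and "closure {x. u0 x \<noteq> 0} = {-s0..s0}"
    and "T < S"
  shows "\<exists>C::real. \<forall>(N::nat) (h::real) (dt::nat \<Rightarrow> real) (n::nat)
            (sm::nat \<Rightarrow> real) (sp::nat \<Rightarrow> real) (u::nat \<Rightarrow> real \<Rightarrow> real).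
          N > 0 \<longrightarrow> h = s0 / real N \<longrightarrow> (\<forall>k<n. dt k > 0) \<longrightarrow>
          numerical_solution m q s0 u0 h dt n sm sp u \<longrightarrow>
          ereal S \<le> T1 m q (u 0) \<longrightarrow>
          Linf_norm (vh h s0 s0 (u 0)) \<le> ereal K \<longrightarrow>
          stability_condition m h dt n sm sp u \<longrightarrow>
          time dt n \<le> T \<longrightarrow>
          Linf_norm (vh h (sm n) (sp n) (u n)) \<le> ereal C"
proof -
  \<comment> \<open>The growth rate from \<open>solution_bounds_step\<close>; it involves neither
    the mesh nor the time steps.\<close>
  define L where "L = 2 * S\<^sup>2 / (q * (S - T) ^ 3)"
  have L: "0 \<le> L" using assms by (simp add: L_def)
  have "Linf_norm (vh h (sm n) (sp n) (u n)) \<le> ereal (K * exp (L * T))"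
    if N: "N > 0" "h = s0 / real N" and dt: "\<forall>k<n. dt k > 0"
      and sol: "numerical_solution m q s0 u0 h dt n sm sp u"
      and S: "ereal S \<le> T1 m q (u 0)" and K: "Linf_norm (vh h s0 s0 (u 0)) \<le> ereal K"
      and stab: "stability_condition m h dt n sm sp u" and T: "time dt n \<le> T"
    for N h dt n sm sp and u :: "nat \<Rightarrow> real \<Rightarrow> real"
  proof -
    have time_mono: "time dt k \<le> time dt l" if "k \<le> l" "l \<le> n" for k l
      unfolding time_def using that dt by (intro sum_mono2) (auto intro: less_imp_le)
    have time_0: "time dt 0 = 0" by (simp add: time_def)
    have S0: "0 < S" using time_mono[of 0 n] time_0 T \<open>T < S\<close> by simp
    have init: "sm 0 = s0" "sp 0 = s0" "u 0 = lagrange h s0 s0 u0"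
      using sol by (simp_all add: numerical_solution_def)
    have "real N \<ge> 1" using N by simp
    then interpret M0: mesh h s0 s0
      using N assms(4) by unfold_locales (auto simp: divide_le_eq_1 pos_divide_le_eq)
    have u_0: "u 0 \<in> Vh h s0 s0" by (simp add: init M0.lagrange_spec)
    \<comment> \<open>A crude bound that may depend on the mesh; it only certifies a finite norm of
      \<open>u 0\<close> and does not enter the final constant.\<close>
    define B where "B = Max (insert 0 ((\<lambda>i. u0 (M0.X i)) ` nodes h s0 s0))"
    have fin: "finite (nodes h s0 s0)" by (simp add: nodes_def)
    have B: "0 \<le> u 0 x \<and> u 0 x \<le> B" for x
    proof (rule M0.Vh_nonneg_le[OF u_0])
      show "0 \<le> B" using fin by (simp add: B_def)
      show "0 \<le> u 0 (M0.X i) \<and> u 0 (M0.X i) \<le> B" if "i \<in> nodes h s0 s0" for i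
        using that fin assms(6) by (simp add: init M0.lagrange_spec B_def)
    qed
    have "continuous_on UNIV (u 0)" using u_0 by (simp add: Vh_def)
    from T1_bound[OF assms(1,2) S0 this B S] obtain M
      where M: "\<And>x. 0 \<le> u 0 x \<and> u 0 x \<le> M" "m * q * M powr q * S \<le> 1"
      by blast
    have slopes_0: "\<forall>i\<in>cells h s0 s0. \<bar>M0.\<sigma> (u 0) i\<bar> \<le> K"
      using K by (simp add: M0.Linf_norm_vh_le_iff)
    have "M0.a \<in> cells h s0 s0" using M0.first_last by (simp add: M0.cells_iff)
    then have K0: "0 \<le> K" using slopes_0 by force
    have bounds: "solution_bounds m q S h (time dt k) (sm k) (sp k) (u k) (K * exp (L * time dt k))"
      if "k \<le> n" for k
      using that
    proof (induction k)
      case 0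
      then show ?case
        using M M0.mesh_axioms u_0 slopes_0 by (auto simp: solution_bounds_def init time_0)
    next
      case (Suc k)
      then have k: "k < n" by simp
      let ?V = "K * exp (L * time dt k)"
      have time_Suc: "time dt (Suc k) = time dt k + dt k" by (simp add: time_def)
      have step:
        "sp (Suc k) = sp k - dt k / m * slope h (sm k) (sp k) (u k) (Nend h (sp k))"
        "sm (Suc k) = sm k + dt k / m * slope h (sm k) (sp k) (u k) (- Nend h (sm k) + 1)"
        "parabolic_step m q (dt k) h (sm (Suc k)) (sp (Suc k))
          (lagrange h (sm (Suc k)) (sp (Suc k)) (hopf_lax m (dt k) (u k))) (u (Suc k))"
        using sol k unfolding numerical_solution_def by blast+
      have "solution_bounds m q S h (time dt k + dt k) (sm (Suc k)) (sp (Suc k)) (u (Suc k))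
          ((1 + 2 * S\<^sup>2 / (q * (S - T) ^ 3) * dt k) * ?V)"
      proof (rule solution_bounds_step[OF assms(1-3) _ _ _ _ _ _ step])
        show "0 < dt k" using dt k by simp
        show "0 \<le> time dt k" using time_mono[of 0 k] time_0 k by simp
        show "time dt k + dt k \<le> T" using time_mono[of "Suc k" n] k T time_Suc by simp
        show "T < S" by fact
        show "solution_bounds m q S h (time dt k) (sm k) (sp k) (u k) ?V"
          using Suc by simp
        show "ereal (dt k / h) * Linf_norm (vh h (sm k) (sp k) (u k)) \<le> ereal (m / 2)"
          using stab k unfolding stability_condition_def by blast
      qed
      \<comment> \<open>Discrete Gronwall: \<open>1 + x \<le> exp x\<close> turns the factors of the
        steps into the exponential of the elapsed time, for any size of the steps.\<close>
      moreover have "(1 + L * dt k) * ?V \<le> K * exp (L * time dt (Suc k))"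
      proof -
        have "(1 + L * dt k) * ?V \<le> exp (L * dt k) * ?V"
          using exp_ge_add_one_self[of "L * dt k"] K0 by (intro mult_right_mono) auto
        also have "\<dots> = K * exp (L * time dt (Suc k))"
          by (simp add: time_Suc distrib_left exp_add)
        finally show ?thesis .
      qed
      ultimately show ?case
        unfolding solution_bounds_def L_def[symmetric] time_Suc by (blast intro: order_trans)
    qed
    have "mesh h (sm n) (sp n)" using bounds[of n] by (simp add: solution_bounds_def)
    then interpret Mn: mesh h "sm n" "sp n" .
    have "K * exp (L * time dt n) \<le> K * exp (L * T)"
      using K0 L T by (intro mult_left_mono) (auto intro: mult_left_mono)
    then have "\<forall>i\<in>cells h (sm n) (sp n). \<bar>Mn.\<sigma> (u n) i\<bar> \<le> K * exp (L * T)"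
      using bounds[of n] unfolding solution_bounds_def by (blast intro: order_trans)
    then show ?thesis by (simp add: Mn.Linf_norm_vh_le_iff)
  qed
  then show ?thesis by blast
qed

end
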